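(* Let $U\subseteq\mathbb{R}^m$ be a nonempty closed convex set, let $F:U\to\mathbb{R}^m$ with $F(u)=\mathbb{E}[\Phi(u,\xi)]$ for all $u\in U$, and assume that the solution set $U^*$ of the variational inequality VI$(U,F)$ is nonempty and closed. Assume that: (i) for some $\sigma>0$ and all $k\ge 0$, $\mathbb{E}[\Phi(h_k,\xi_k)-F(h_k)\mid h_k]=0$ and $\mathbb{E}[\|\Phi(h_k,\xi_k)-F(h_k)\|^2\mid h_k]\le\sigma^2$; (ii) $F$ is Lipschitz continuous over $U$ with a constant $L>0$: $\|F(u)-F(u')\|\le L\|u-u'\|$ for all $u,u'\in U$; (iii) $F$ is $2$-quasi sharp over $U$ relative to $U^*$: for some $\mu>0$, $\langle F(u),u-u^*\rangle\ge\mu\,\mathrm{dist}^2(u,U^* )$ for all $u\in U$ and all $u^*\in U^*$. For any given $K\ge 2$, let the stepsizes $\alpha_k$, $0\le k\le K$, be given by the $(a,d,K)$-stepsize rule (defined in the context) with $a=\mu$ and $d\ge\max\{2\sqrt3\,L,\ \mu\}$. Then, for all $K\ge 2$, the iterates generated by the stochastic Popov method satisfy $$\mathbb{E}\left[\mathrm{dist}^2(u_{K+1},U^* )\right]\le\frac{32d}{\mu}\,r_1\,e^{-\frac{\mu(K-1)}{2d}}+\frac{432\sigma^2}{\mu^2(K-1)},$$ where $r_1=\mathbb{E}\left[\mathrm{dist}^2(u_1,U^* )+\|h_0-u_1\|^2\right]$.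
   Context: The variational inequality VI$(U,F)$ is the problem of finding $u^*\in U$ with $\langle F(u^* ),u-u^*\rangle\ge 0$ for all $u\in U$; $U^*$ is the set of all such $u^*$. $\|\cdot\|$ is the Euclidean norm, $P_U(u)=\arg\min_{v\in U}\|v-u\|$ is the projection onto $U$, $\mathrm{dist}(u,Y)=\inf_{y\in Y}\|u-y\|$, and $\mathrm{dist}^2(u,Y)=(\mathrm{dist}(u,Y))^2$. Here $\Phi:U\times\mathbb{R}^d\to\mathbb{R}^m$ is a stochastic operator and $\xi$ is a $d$-dimensional random vector (this dimension $d$ is unrelated to the stepsize parameter $d$). Stochastic Popov method: given arbitrary deterministic points $u_0,h_0\in U$ and stepsizes $\alpha_k>0$, at each iteration $k\ge 0$, having $h_k$, a random sample $\xi_k$ is drawn according to the distribution of $\xi$, and $$u_{k+1}=P_U(u_k-\alpha_k\Phi(h_k,\xi_k)),\qquad h_{k+1}=P_U(u_{k+1}-\alpha_{k+1}\Phi(h_k,\xi_k)).$$ The $(a,d,K)$-stepsize rule, for real $d\ge a>0$ and an integer $K\ge 0$: with $k_0=\lceil K/2\rceil$, for $0\le k\le K$, $$\alpha_k=\frac1d\ \text{ if }K\le\frac da;\qquad \alpha_k=\frac1d\ \text{ if }K>\frac da\text{ and }k<k_0;\qquad \alpha_k=\frac{2}{a\left(\frac{2d}{a}+k-k_0\right)}\ \text{ if }K>\frac da\text{ and }k\ge k_0.$$ *)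

theory Defs
  imports "HOL-Probability.Probability"
begin

definition VI_solutions :: "'a::real_inner set \<Rightarrow> ('a \<Rightarrow> 'a) \<Rightarrow> 'a set" where
  "VI_solutions U F = {u \<in> U. \<forall>v\<in>U. 0 \<le> F u \<bullet> (v - u)}"

text \<open>
  The recursion of the stochastic Popov method is run pathwise; \<open>\<xi> k \<omega>\<close> is the sample
  drawn at iteration \<open>k\<close>. The projection onto \<open>U\<close> is the library's \<open>closest_point\<close>.
\<close>

fun popov_u :: "'a::euclidean_space set \<Rightarrow> ('a \<Rightarrow> 's \<Rightarrow> 'a) \<Rightarrow> (nat \<Rightarrow> real) \<Rightarrow> 'a \<Rightarrow> 'a
      \<Rightarrow> (nat \<Rightarrow> 'w \<Rightarrow> 's) \<Rightarrow> nat \<Rightarrow> 'w \<Rightarrow> 'a"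
  and popov_h :: "'a::euclidean_space set \<Rightarrow> ('a \<Rightarrow> 's \<Rightarrow> 'a) \<Rightarrow> (nat \<Rightarrow> real) \<Rightarrow> 'a \<Rightarrow> 'a
      \<Rightarrow> (nat \<Rightarrow> 'w \<Rightarrow> 's) \<Rightarrow> nat \<Rightarrow> 'w \<Rightarrow> 'a"
where
  "popov_u U \<Phi> \<alpha> u0 h0 \<xi> 0 \<omega> = u0"
| "popov_u U \<Phi> \<alpha> u0 h0 \<xi> (Suc k) \<omega> =
     closest_point U (popov_u U \<Phi> \<alpha> u0 h0 \<xi> k \<omega> - \<alpha> k *\<^sub>R \<Phi> (popov_h U \<Phi> \<alpha> u0 h0 \<xi> k \<omega>) (\<xi> k \<omega>))"
| "popov_h U \<Phi> \<alpha> u0 h0 \<xi> 0 \<omega> = h0"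
| "popov_h U \<Phi> \<alpha> u0 h0 \<xi> (Suc k) \<omega> =
     closest_point U (popov_u U \<Phi> \<alpha> u0 h0 \<xi> (Suc k) \<omega>
       - \<alpha> (Suc k) *\<^sub>R \<Phi> (popov_h U \<Phi> \<alpha> u0 h0 \<xi> k \<omega>) (\<xi> k \<omega>))"

text \<open>The stepsize rule with parameters \<open>a\<close>, \<open>d\<close>, \<open>K\<close>; it is meant for indices \<open>k \<le> K\<close>.\<close>

definition stepsize_rule :: "real \<Rightarrow> real \<Rightarrow> nat \<Rightarrow> nat \<Rightarrow> real" where
  "stepsize_rule a d K k =
     (let k0 = nat \<lceil>real K / 2\<rceil> in
      if real K \<le> d / a then 1 / d
      else if k < k0 then 1 / d
      else 2 / (a * (2 * d / a + real k - real k0)))"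

abbreviation sigma_gen :: "'w measure \<Rightarrow> ('w \<Rightarrow> 'b::topological_space) \<Rightarrow> 'w measure" where
  "sigma_gen M X \<equiv> vimage_algebra (space M) X borel"

text \<open>
  Conditional expectation of the random vector \<open>Y\<close> given \<open>X\<close>. The library provides it for
  real-valued functions, so it is taken in each coordinate.
\<close>

definition vec_cond_exp ::
  "'w measure \<Rightarrow> ('w \<Rightarrow> 'b::topological_space) \<Rightarrow> ('w \<Rightarrow> 'a::euclidean_space) \<Rightarrow> 'w \<Rightarrow> 'a" where
  "vec_cond_exp M X Y \<omega> =
     (\<Sum>b\<in>Basis. real_cond_exp M (sigma_gen M X) (\<lambda>\<omega>'. Y \<omega>' \<bullet> b) \<omega> *\<^sub>R b)"

text \<open>
  For a nonnegative random variable the conditional expectation is taken in the extended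
  nonnegative reals: a finite bound on it then also expresses integrability, whereas
  \<^const>\<open>real_cond_exp\<close> would turn an infinite value into 0.
\<close>

abbreviation nonneg_cond_exp ::
  "'w measure \<Rightarrow> ('w \<Rightarrow> 'b::topological_space) \<Rightarrow> ('w \<Rightarrow> real) \<Rightarrow> 'w \<Rightarrow> ennreal" where
  "nonneg_cond_exp M X Y \<equiv> nn_cond_exp M (sigma_gen M X) (\<lambda>\<omega>. ennreal (Y \<omega>))"

end

theory Submission
  imports Defs
begin

text \<open>
  The method is analysed through the potential
  \<open>V\<^sub>k = dist\<^sup>2(u\<^sub>k, U\<^sup>*) + \<parallel>h\<^sub>k\<^sub>-\<^sub>1 - u\<^sub>k\<parallel>\<^sup>2 / 3\<close>. With \<open>e\<^sub>k\<close> the noise of step \<open>k\<close>, a pathwise estimate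
  gives \<open>V\<^sub>k\<^sub>+\<^sub>1 \<le> exp (- \<mu> \<alpha>\<^sub>k) V\<^sub>k + \<alpha>\<^sub>k\<^sup>2 (7 \<parallel>e\<^sub>k\<parallel>\<^sup>2 + 11 \<parallel>e\<^sub>k\<^sub>-\<^sub>1\<parallel>\<^sup>2) + \<langle>e\<^sub>k, b\<rangle>\<close> where \<open>b\<close> depends only
  on the past. The stepsize may be as large as \<open>\<mu> \<alpha>\<^sub>k = 1\<close>, and two arguments are needed: for
  \<open>\<mu> \<alpha>\<^sub>k \<le> 7/20\<close> quasi-sharpness is used at \<open>h\<^sub>k\<close>, for \<open>\<mu> \<alpha>\<^sub>k \<ge> 7/20\<close> at \<open>u\<^sub>k\<^sub>+\<^sub>1\<close>, which yields the
  contraction factor of an implicit step, about \<open>1 / (1 + 2 \<mu> \<alpha>\<^sub>k)\<close>.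

  Since \<open>\<xi>\<^sub>k\<close> is independent of the past, the past can be frozen and only \<open>\<xi>\<^sub>k\<close> integrated, which
  kills \<open>\<langle>e\<^sub>k, b\<rangle>\<close>; the nearest point of \<open>U\<^sup>*\<close> entering \<open>b\<close> is then a constant and need not be
  chosen measurably. Hence \<open>\<bbbE> V\<^sub>k\<^sub>+\<^sub>1 \<le> exp (- \<mu> \<alpha>\<^sub>k) \<bbbE> V\<^sub>k + 18 \<alpha>\<^sub>k\<^sup>2 \<sigma>\<^sup>2\<close>, and the stepsize rule solves this
  recursion: the noise contributes at most \<open>36 \<sigma>\<^sup>2 / (\<mu> d)\<close> in the constant phase, and at most
  \<open>216 \<sigma>\<^sup>2 / (\<mu>\<^sup>2 (2 d / \<mu> + j))\<close> after \<open>j\<close> steps of the decreasing phase.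
\<close>

section \<open>The pathwise estimate\<close>

text \<open>\<open>v\<close> and \<open>h\<close> are steps from the same \<open>u\<close>, with the
  current and the previous sample. The obtuse-angle inequality of the projection \<open>v\<close>,
  tested at \<open>y\<close>, gives the first claim; adding that of \<open>h\<close>, tested at
  \<open>v\<close>, gives the third. The long step rests on the first, the short step on the third,
  both on the second.\<close>

lemma popov_projection_inequalities:
  fixes U :: "'a::euclidean_space set"
  assumes U: "convex U" "closed U" and y: "y \<in> U"
    and v: "v = closest_point U (u - \<alpha> *\<^sub>R g)"
    and h: "h = closest_point U (u - \<alpha> *\<^sub>R g')"
    and \<alpha>: "\<alpha> > 0"
  shows "(norm (v - y))\<^sup>2 \<le> (norm (u - y))\<^sup>2 - (norm (v - u))\<^sup>2 - 2 * \<alpha> * (g \<bullet> (v - y))"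
    and "norm (h - v) \<le> \<alpha> * norm (g - g')"
    and "(norm (v - y))\<^sup>2 + (norm (h - v))\<^sup>2
      \<le> (norm (u - y))\<^sup>2 - (norm (h - u))\<^sup>2 - 2 * \<alpha> * (g \<bullet> (h - y)) + 2 * \<alpha> * ((g - g') \<bullet> (h - v))"
proof -
  have vU: "v \<in> U" unfolding v using U y by (intro closest_point_in_set) auto
  have A: "(u - \<alpha> *\<^sub>R g - v) \<bullet> (y - v) \<le> 0"
    unfolding v using U y by (intro closest_point_dot) auto
  have B: "(u - \<alpha> *\<^sub>R g' - h) \<bullet> (v - h) \<le> 0"
    unfolding h using U vU by (intro closest_point_dot) auto
  show 1: "(norm (v - y))\<^sup>2 \<le> (norm (u - y))\<^sup>2 - (norm (v - u))\<^sup>2 - 2 * \<alpha> * (g \<bullet> (v - y))"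
    using A unfolding power2_norm_eq_inner by (simp add: inner_simps inner_commute algebra_simps)
  have "(norm (h - v))\<^sup>2 \<le> (norm (u - v))\<^sup>2 - (norm (h - u))\<^sup>2 - 2 * \<alpha> * (g' \<bullet> (h - v))"
    using B unfolding power2_norm_eq_inner by (simp add: inner_simps inner_commute algebra_simps)
  moreover have "g \<bullet> (v - y) = g \<bullet> (h - y) - g \<bullet> (h - v)"
    by (simp add: inner_simps)
  ultimately show "(norm (v - y))\<^sup>2 + (norm (h - v))\<^sup>2
      \<le> (norm (u - y))\<^sup>2 - (norm (h - u))\<^sup>2 - 2 * \<alpha> * (g \<bullet> (h - y)) + 2 * \<alpha> * ((g - g') \<bullet> (h - v))"
    using 1 by (simp add: norm_minus_commute[of u v] inner_diff_left algebra_simps)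
  have "dist h v \<le> dist (u - \<alpha> *\<^sub>R g') (u - \<alpha> *\<^sub>R g)"
    unfolding h v using U y by (intro closest_point_lipschitz) auto
  also have "\<dots> = norm (\<alpha> *\<^sub>R (g - g'))"
    by (simp add: dist_norm algebra_simps)
  finally show "norm (h - v) \<le> \<alpha> * norm (g - g')"
    using \<alpha> by (simp add: dist_norm)
qed

lemma power2_sum_le_weighted:
  fixes a b c :: real
  assumes "c > 0"
  shows "(a + b)\<^sup>2 \<le> (1 + c) * a\<^sup>2 + (1 + 1 / c) * b\<^sup>2"
proof -
  have "0 \<le> (c * a - b)\<^sup>2 / c" using assms by simp
  also have "\<dots> = c * a\<^sup>2 + b\<^sup>2 / c - 2 * a * b"
    using assms by (simp add: power2_eq_square field_simps)
  finally show ?thesis by (simp add: power2_eq_square field_simps)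
qed

text \<open>By convexity: the line joins \<open>(7 / 20, 71 / 50)\<close> to
  \<open>(1, 68 / 25)\<close>, upper bounds for exp at the endpoints. They are rounded so that the
  slope is exactly 2, the coefficient of \<open>\<mu> * \<alpha>\<close> in an implicit
  step.\<close>

lemma exp_le_chord:
  assumes "7 / 20 \<le> t" "t \<le> (1::real)"
  shows "exp t \<le> 18 / 25 + 2 * t"
proof -
  have e1: "exp 1 \<le> (272 / 100 :: real)" using e_less_272 by simp
  \<comment> \<open>The 20th power reduces the left endpoint to the numerical bound for e.\<close>
  have "exp (7 / 20) ^ 20 = (exp 1 :: real) ^ 7"
    by (simp flip: exp_of_nat_mult)
  also have "\<dots> \<le> (272 / 100) ^ 7" by (intro power_mono e1) simp
  also have "\<dots> \<le> (71 / 50 :: real) ^ 20" by (simp add: power_divide divide_simps)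
  finally have e2: "exp (7 / 20) \<le> (71 / 50 :: real)"
    by (rule power_le_imp_le_base[of _ 19, simplified]) simp
  define w where "w = (t - 7 / 20) / (13 / 20)"
  have w: "0 \<le> w" "w \<le> 1" "t = (1 - w) * (7 / 20) + w * 1"
    using assms by (auto simp: w_def field_simps)
  have "exp t \<le> (1 - w) * exp (7 / 20) + w * exp 1"
    using convex_onD[OF exp_convex, of w "7/20" 1] w by simp
  also have "\<dots> \<le> (1 - w) * (71 / 50) + w * (272 / 100)"
    using w e1 e2 by (intro add_mono mult_left_mono) auto
  also have "\<dots> = 18 / 25 + 2 * t" unfolding w(3) by (simp add: field_simps)
  finally show ?thesis .
qed

text \<open>In the short step two thirds of \<open>(norm (h - v))\<^sup>2\<close> absorb the cross
  term with the sample difference; the weight 1/3 is what remains.\<close>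

definition popov_potential :: "'a::euclidean_space set \<Rightarrow> 'a \<Rightarrow> 'a \<Rightarrow> real" where
  "popov_potential Y u h = (infdist u Y)\<^sup>2 + (norm (h - u))\<^sup>2 / 3"

locale quasi_sharp_vi =
  fixes U Y :: "'a::euclidean_space set" and F :: "'a \<Rightarrow> 'a" and L \<mu> :: real
  assumes U: "convex U" "closed U"
    and Y: "Y \<subseteq> U" "Y \<noteq> {}" "closed Y"
    and lipschitz: "L-lipschitz_on U F"
    and sharp: "\<And>v y. v \<in> U \<Longrightarrow> y \<in> Y \<Longrightarrow> \<mu> * (infdist v Y)\<^sup>2 \<le> F v \<bullet> (v - y)"
    and L_pos: "L > 0" and \<mu>_pos: "\<mu> > 0"
begin

lemma U_nonempty: "U \<noteq> {}"
  using Y by auto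

lemma norm_F_diff_le:
  assumes "v \<in> U" "w \<in> U"
  shows "norm (F v - F w) \<le> L * norm (v - w)"
  using lipschitz_onD[OF lipschitz assms] by (simp add: dist_norm)

text \<open>The quantifier order matters: \<open>b\<close> is fixed before \<open>e\<close>, so
  \<open>e \<bullet> b\<close> averages out. Sharpness controls the distance of \<open>h\<close>,
  and \<open>D_le\<close> transfers it to \<open>u\<close>. For
  \<open>\<mu> * \<alpha> \<le> 7 / 20\<close> this transfer uses at most 7/10 of the available
  \<open>- q\<^sup>2\<close>; the rest pays for the Lipschitz error.\<close>

lemma popov_step_short:
  assumes h: "h = closest_point U (u - \<alpha> *\<^sub>R g')" and h': "h' \<in> U"
    and \<alpha>: "\<alpha> > 0" and \<alpha>L: "12 * (\<alpha> * L)\<^sup>2 \<le> 1" and t: "\<mu> * \<alpha> \<le> 7 / 20"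
  shows "\<exists>b. \<forall>e. popov_potential Y (closest_point U (u - \<alpha> *\<^sub>R (F h + e))) h
      \<le> exp (- (\<mu> * \<alpha>)) * popov_potential Y u h'
        + \<alpha>\<^sup>2 * (7 * (norm e)\<^sup>2 + 11 * (norm (g' - F h'))\<^sup>2) + e \<bullet> b"
proof -
  obtain y where y: "y \<in> Y" "infdist u Y = dist u y"
    using infdist_attains_inf[OF Y(3,2)] by blast
  then have yU: "y \<in> U" using Y by auto
  have hU: "h \<in> U" unfolding h using U U_nonempty by (intro closest_point_in_set) auto
  define q p where "q = norm (h - u)" and "p = norm (h' - u)"
  define D where "D = (infdist u Y)\<^sup>2"
  define \<delta> where "\<delta> = infdist h Y"
  have D_nn: "D \<ge> 0" by (simp add: D_def)
  have t_pos: "\<mu> * \<alpha> > 0" using \<mu>_pos \<alpha> by simp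
  \<comment> \<open>The Young weights 6/5 and 1/7 are tuned for \<open>det\<close>, where 4/3 of
    this bound enters: \<open>32 / 252 * (11 / 5)\<close> stays below the 3/10 left of
    \<open>q\<^sup>2\<close>, and \<open>32 / 252 * (11 / 6)\<close> just below 7/10 of the weight
    1/3 of \<open>p\<^sup>2\<close>.\<close>
  have F: "\<alpha>\<^sup>2 * (norm (F h - g'))\<^sup>2 \<le> 8 / 84 * ((11 / 5) * q\<^sup>2 + (11 / 6) * p\<^sup>2)
      + 8 * \<alpha>\<^sup>2 * (norm (g' - F h'))\<^sup>2"
  proof -
    have "norm (h - h') \<le> q + p"
      unfolding q_def p_def by (metis norm_triangle_ineq4 diff_diff_eq2 diff_add_cancel)
    then have "(norm (h - h'))\<^sup>2 \<le> (q + p)\<^sup>2" by (intro power_mono) auto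
    also have "\<dots> \<le> (11 / 5) * q\<^sup>2 + (11 / 6) * p\<^sup>2"
      using power2_sum_le_weighted[of "6/5" q p] by simp
    finally have hh: "(norm (h - h'))\<^sup>2 \<le> (11 / 5) * q\<^sup>2 + (11 / 6) * p\<^sup>2" .
    have "norm (F h - g') \<le> norm (F h - F h') + norm (g' - F h')"
      by (metis norm_triangle_ineq4 diff_diff_eq2 diff_add_cancel)
    also have "\<dots> \<le> L * norm (h - h') + norm (g' - F h')"
      using norm_F_diff_le[OF hU h'] by simp
    finally have "(norm (F h - g'))\<^sup>2 \<le> (L * norm (h - h') + norm (g' - F h'))\<^sup>2"
      by (intro power_mono) auto
    also have "\<dots> \<le> (8 / 7) * (L * norm (h - h'))\<^sup>2 + 8 * (norm (g' - F h'))\<^sup>2"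
      using power2_sum_le_weighted[of "1/7" "L * norm (h - h')" "norm (g' - F h')"] by simp
    finally have "\<alpha>\<^sup>2 * (norm (F h - g'))\<^sup>2 \<le> \<alpha>\<^sup>2 * ((8 / 7) * (L * norm (h - h'))\<^sup>2 + 8 * (norm (g' - F h'))\<^sup>2)"
      by (intro mult_left_mono) auto
    also have "\<dots> = 8 / 7 * ((\<alpha> * L)\<^sup>2 * (norm (h - h'))\<^sup>2) + 8 * \<alpha>\<^sup>2 * (norm (g' - F h'))\<^sup>2"
      by (simp add: power_mult_distrib algebra_simps)
    also have "(\<alpha> * L)\<^sup>2 * (norm (h - h'))\<^sup>2 \<le> 1 / 12 * ((11 / 5) * q\<^sup>2 + (11 / 6) * p\<^sup>2)"
      using \<alpha>L hh by (intro mult_mono) auto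
    finally show ?thesis by linarith
  qed
  have D_le: "D \<le> 2 * \<delta>\<^sup>2 + 2 * q\<^sup>2"
  proof -
    have "infdist u Y \<le> \<delta> + q"
      using infdist_triangle[of u Y h] by (simp add: \<delta>_def q_def dist_norm norm_minus_commute)
    then have "D \<le> (\<delta> + q)\<^sup>2" unfolding D_def by (intro power_mono infdist_nonneg) auto
    also have "\<dots> \<le> 2 * \<delta>\<^sup>2 + 2 * q\<^sup>2" using power2_sum_le_weighted[of 1 \<delta> q] by simp
    finally show ?thesis .
  qed
  have sh: "\<mu> * \<delta>\<^sup>2 \<le> F h \<bullet> (h - y)" unfolding \<delta>_def by (intro sharp hU y)
  have det: "D - q\<^sup>2 - 2 * \<alpha> * (F h \<bullet> (h - y)) + 32 / 252 * ((11 / 5) * q\<^sup>2 + (11 / 6) * p\<^sup>2)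
      \<le> exp (- (\<mu> * \<alpha>)) * (D + p\<^sup>2 / 3)"
  proof -
    have "\<mu> * \<alpha> * D \<le> \<mu> * \<alpha> * (2 * \<delta>\<^sup>2 + 2 * q\<^sup>2)"
      using t_pos D_le by (intro mult_left_mono) auto
    also have "\<dots> = 2 * \<alpha> * (\<mu> * \<delta>\<^sup>2) + 2 * (\<mu> * \<alpha>) * q\<^sup>2"
      by (simp add: algebra_simps)
    finally have "\<mu> * \<alpha> * D \<le> 2 * \<alpha> * (\<mu> * \<delta>\<^sup>2) + 2 * (\<mu> * \<alpha>) * q\<^sup>2" .
    moreover have "2 * (\<mu> * \<alpha>) * q\<^sup>2 \<le> 2 * (7 / 20) * q\<^sup>2"
      using t by (intro mult_right_mono) auto
    moreover have "2 * \<alpha> * (\<mu> * \<delta>\<^sup>2) \<le> 2 * \<alpha> * (F h \<bullet> (h - y))"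
      using sh \<alpha> by (intro mult_left_mono) auto
    ultimately have "\<mu> * \<alpha> * D \<le> 2 * \<alpha> * (F h \<bullet> (h - y)) + 7 / 10 * q\<^sup>2"
      by linarith
    moreover have "(1 - \<mu> * \<alpha>) * D = D - \<mu> * \<alpha> * D"
      by (simp add: algebra_simps)
    ultimately have "D - q\<^sup>2 - 2 * \<alpha> * (F h \<bullet> (h - y)) + 32 / 252 * ((11 / 5) * q\<^sup>2 + (11 / 6) * p\<^sup>2)
      \<le> (1 - \<mu> * \<alpha>) * D + 7 / 10 * (p\<^sup>2 / 3)"
      using zero_le_power2[of q] zero_le_power2[of p] unfolding distrib_left by linarith
    also have "\<dots> \<le> exp (- (\<mu> * \<alpha>)) * D + exp (- (\<mu> * \<alpha>)) * (p\<^sup>2 / 3)"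
    proof -
      have "1 - \<mu> * \<alpha> \<le> exp (- (\<mu> * \<alpha>))" using exp_ge_add_one_self[of "-(\<mu> * \<alpha>)"] by simp
      then have "(1 - \<mu> * \<alpha>) * D \<le> exp (- (\<mu> * \<alpha>)) * D" using D_nn by (intro mult_right_mono)
      moreover have "7 / 10 \<le> exp (- (\<mu> * \<alpha>))"
      proof -
        have "exp (\<mu> * \<alpha>) \<le> exp (7 / 20)" using t by simp
        also have "\<dots> \<le> 142 / 100" using exp_le_chord[of "7/20"] by simp
        finally show ?thesis by (simp add: exp_minus field_simps)
      qed
      then have "7 / 10 * (p\<^sup>2 / 3) \<le> exp (- (\<mu> * \<alpha>)) * (p\<^sup>2 / 3)" by (intro mult_right_mono) auto
      ultimately show ?thesis using zero_le_power2[of q] by linarith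
    qed
    finally show ?thesis by (simp add: algebra_simps)
  qed
  \<comment> \<open>All terms linear in \<open>e\<close>: the cross term of
    \<open>(norm (g - g'))\<^sup>2\<close> scaled by \<open>4 / 3 * \<alpha>\<^sup>2\<close>, and
    the noise part of the gradient term. Neither \<open>h\<close> nor \<open>y\<close> depends on
    \<open>e\<close>.\<close>
  define b where "b = (8 / 3 * \<alpha>\<^sup>2) *\<^sub>R (F h - g') - (2 * \<alpha>) *\<^sub>R (h - y)"
  have "popov_potential Y (closest_point U (u - \<alpha> *\<^sub>R (F h + e))) h
      \<le> exp (- (\<mu> * \<alpha>)) * popov_potential Y u h'
        + \<alpha>\<^sup>2 * (7 * (norm e)\<^sup>2 + 11 * (norm (g' - F h'))\<^sup>2) + e \<bullet> b" for e
  proof -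
    define v where "v = closest_point U (u - \<alpha> *\<^sub>R (F h + e))"
    define g where "g = F h + e"
    define r where "r = norm (h - v)"
    define x where "x = \<alpha> * norm (g - g')"
    note P = popov_projection_inequalities[OF U yU v_def[folded g_def] h \<alpha>]
    have rx: "r \<le> x" using P(2) by (simp add: r_def x_def)
    have r_nn: "r \<ge> 0" by (simp add: r_def)
    have "(infdist v Y)\<^sup>2 \<le> (norm (v - y))\<^sup>2"
      using infdist_le[OF y(1), of v] by (intro power_mono infdist_nonneg) (simp add: dist_norm)
    moreover have "(norm (v - y))\<^sup>2 + r\<^sup>2 \<le> D - q\<^sup>2 - 2 * \<alpha> * (g \<bullet> (h - y)) + 2 * \<alpha> * ((g - g') \<bullet> (h - v))"
      using P(3) by (simp add: r_def D_def y(2) dist_norm q_def)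
    moreover have "2 * \<alpha> * ((g - g') \<bullet> (h - v)) \<le> 2 * x * r"
      using norm_cauchy_schwarz[of "g - g'" "h - v"] \<alpha> by (simp add: x_def r_def mult.assoc)
    \<comment> \<open>this uses \<open>r \<le> x\<close>; Young's inequality alone would give the larger \<open>3 / 2 * x\<^sup>2\<close>\<close>
    moreover have "2 * x * r \<le> 2 / 3 * r\<^sup>2 + 4 / 3 * x\<^sup>2"
    proof -
      have "0 \<le> (x - r) * (2 * x - r)" using rx r_nn by (intro mult_nonneg_nonneg) auto
      then show ?thesis by (simp add: power2_eq_square algebra_simps)
    qed
    moreover have "x\<^sup>2 = \<alpha>\<^sup>2 * (norm (F h - g'))\<^sup>2 + \<alpha>\<^sup>2 * (norm e)\<^sup>2 + 2 * \<alpha>\<^sup>2 * (e \<bullet> (F h - g'))"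
    proof -
      have "(norm (g - g'))\<^sup>2 = (norm (F h - g'))\<^sup>2 + (norm e)\<^sup>2 + 2 * (e \<bullet> (F h - g'))"
        unfolding g_def power2_norm_eq_inner by (simp add: inner_simps inner_commute)
      then show ?thesis by (simp only: x_def power_mult_distrib distrib_left mult.assoc mult.left_commute[of _ 2])
    qed
    moreover have "g \<bullet> (h - y) = F h \<bullet> (h - y) + e \<bullet> (h - y)" by (simp add: g_def inner_simps)
    then have "2 * \<alpha> * (g \<bullet> (h - y)) = 2 * \<alpha> * (F h \<bullet> (h - y)) + 2 * \<alpha> * (e \<bullet> (h - y))"
      by (simp only: distrib_left)
    moreover have "e \<bullet> b = 8 / 3 * \<alpha>\<^sup>2 * (e \<bullet> (F h - g')) - 2 * \<alpha> * (e \<bullet> (h - y))"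
      by (simp only: b_def inner_diff_right inner_scaleR_right)
    ultimately have "(infdist v Y)\<^sup>2 + r\<^sup>2 / 3 \<le> exp (- (\<mu> * \<alpha>)) * (D + p\<^sup>2 / 3)
        + 4 / 3 * (\<alpha>\<^sup>2 * (norm e)\<^sup>2) + 32 / 3 * (\<alpha>\<^sup>2 * (norm (g' - F h'))\<^sup>2) + e \<bullet> b"
      using det F by linarith
    \<comment> \<open>Relaxed to constants shared with the long step: 11 is dictated here, 7
      there.\<close>
    also have "\<dots> \<le> exp (- (\<mu> * \<alpha>)) * (D + p\<^sup>2 / 3)
        + 7 * (\<alpha>\<^sup>2 * (norm e)\<^sup>2) + 11 * (\<alpha>\<^sup>2 * (norm (g' - F h'))\<^sup>2) + e \<bullet> b"
      by (intro add_mono mult_right_mono) (use D_nn in auto)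
    finally show ?thesis
      unfolding popov_potential_def v_def[symmetric] r_def D_def p_def by (simp add: algebra_simps)
  qed
  then show ?thesis by blast
qed

text \<open>Sharpness at the new point \<open>v\<close> puts \<open>2 * (\<mu> * \<alpha>)\<close>
  times its squared distance on the left, as in an implicit step. The price is a Lipschitz error in
  \<open>r\<close>, the distance from \<open>h\<close> to \<open>v\<close>; bounding
  \<open>r\<close> through \<open>w\<close>, \<open>p\<close> and the noise lets
  \<open>- w\<^sup>2\<close> pay for it.\<close>

lemma popov_step_long:
  assumes h: "h = closest_point U (u - \<alpha> *\<^sub>R g')" and h': "h' \<in> U"
    and \<alpha>: "\<alpha> > 0" and \<alpha>L: "12 * (\<alpha> * L)\<^sup>2 \<le> 1" and t: "7 / 20 \<le> \<mu> * \<alpha>" "\<mu> * \<alpha> \<le> 1"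
  shows "\<exists>b. \<forall>e. popov_potential Y (closest_point U (u - \<alpha> *\<^sub>R (F h + e))) h
      \<le> exp (- (\<mu> * \<alpha>)) * popov_potential Y u h'
        + \<alpha>\<^sup>2 * (7 * (norm e)\<^sup>2 + 11 * (norm (g' - F h'))\<^sup>2) + e \<bullet> b"
proof -
  obtain y where y: "y \<in> Y" "infdist u Y = dist u y"
    using infdist_attains_inf[OF Y(3,2)] by blast
  then have yU: "y \<in> U" using Y by auto
  have hU: "h \<in> U" unfolding h using U U_nonempty by (intro closest_point_in_set) auto
  define p where "p = norm (h' - u)"
  define D where "D = (infdist u Y)\<^sup>2"
  have D_nn: "D \<ge> 0" by (simp add: D_def)
  \<comment> \<open>The implicit factor \<open>1 + 2 * (\<mu> * \<alpha>)\<close> less 7/25, twice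
    the share 7/50 of \<open>a\<^sup>2\<close> lost to the Lipschitz error. It is the chord of
    \<open>exp_le_chord\<close>.\<close>
  define m where "m = 18 / 25 + 2 * (\<mu> * \<alpha>)"
  have m: "71 / 50 \<le> m" "m \<le> 68 / 25" using t unfolding m_def by linarith+
  \<comment> \<open>Coefficient of \<open>r\<^sup>2\<close> after division by \<open>m\<close>:
    twice the 25/168 of the Lipschitz error, and the weight of the potential.\<close>
  define \<psi> where "\<psi> = (25 / 84) / m + 1 / 3"
  have \<psi>: "0 \<le> \<psi>" "\<psi> \<le> 544 / 1000" and \<psi>m: "m * \<psi> = 25 / 84 + m / 3"
    using m by (auto simp: \<psi>_def field_simps)
  define l where "l = \<alpha> * L"
  have l_pos: "l > 0" using \<alpha> L_pos by (simp add: l_def)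
  have l2: "l\<^sup>2 \<le> 1 / 12" using \<alpha>L by (simp add: l_def)
  have l: "l \<le> 2887 / 10000"
    by (rule power2_le_imp_le) (use l2 in \<open>auto simp: power2_eq_square\<close>)
  \<comment> \<open>\<open>r\<close> occurs in its own bound with factor \<open>l\<close>, at most
    2887/10000, which rounds up \<open>1 / sqrt 12\<close>. Absorbing it leaves 7113/10000, squared
    in \<open>c\<close>; \<theta> then turns \<open>c * r\<^sup>2\<close> into
    \<open>\<psi> * r\<^sup>2\<close>.\<close>
  define c :: real where "c = (7113 / 10000)\<^sup>2"
  have c_pos: "c > 0" by (simp add: c_def)
  define \<theta> where "\<theta> = \<psi> / c"
  have \<theta>: "0 \<le> \<theta>" "\<theta> \<le> 1076 / 1000"
    using \<psi> by (auto simp: \<theta>_def c_def power2_eq_square field_simps)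
  \<comment> \<open>Lets \<open>- w\<^sup>2 / m\<close> cancel the \<open>w\<^sup>2\<close> coming
    from the bound on \<open>r\<^sup>2\<close>. It is nearly tight at \<open>m = 68 / 25\<close>,
    that is at \<open>\<mu> * \<alpha> = 1\<close>.\<close>
  have \<theta>m: "5 / 12 * \<theta> \<le> 1 / m"
  proof -
    have "5 / 12 * (m * \<psi>) \<le> c" unfolding \<psi>m c_def using m by (simp add: power2_eq_square)
    then show ?thesis using m c_pos by (simp add: \<theta>_def field_simps)
  qed
  \<comment> \<open>\<open>z\<close> is the noiseless next iterate: \<open>e \<bullet> (v - y)\<close> is split at \<open>z\<close>, since \<open>v\<close> depends on \<open>e\<close>\<close>
  define z where "z = closest_point U (u - \<alpha> *\<^sub>R F h)"
  \<comment> \<open>The second summand is the cross term of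
    \<open>(norm (e - (g' - F h')))\<^sup>2\<close>, kept exactly because it is linear in
    \<open>e\<close>.\<close>
  define b where "b = (- (2 * \<alpha> / m)) *\<^sub>R (z - y) - (10 * \<theta> * \<alpha>\<^sup>2) *\<^sub>R (g' - F h')"
  have "popov_potential Y (closest_point U (u - \<alpha> *\<^sub>R (F h + e))) h
      \<le> exp (- (\<mu> * \<alpha>)) * popov_potential Y u h'
        + \<alpha>\<^sup>2 * (7 * (norm e)\<^sup>2 + 11 * (norm (g' - F h'))\<^sup>2) + e \<bullet> b" for e
  proof -
    define g where "g = F h + e"
    define v where "v = closest_point U (u - \<alpha> *\<^sub>R g)"
    define r w a where "r = norm (h - v)" and "w = norm (v - u)" and "a = norm (v - y)"
    have vU: "v \<in> U" unfolding v_def using U U_nonempty by (intro closest_point_in_set) auto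
    note P = popov_projection_inequalities[OF U yU v_def h \<alpha>]
    have r_nn: "r \<ge> 0" by (simp add: r_def)
    have da: "(infdist v Y)\<^sup>2 \<le> a\<^sup>2"
      using infdist_le[OF y(1), of v] unfolding a_def
      by (intro power_mono infdist_nonneg) (simp add: dist_norm)
    have "a\<^sup>2 \<le> D - w\<^sup>2 - 2 * \<alpha> * (g \<bullet> (v - y))"
      using P(1) by (simp add: a_def w_def D_def y(2) dist_norm)
    moreover have "g \<bullet> (v - y) = F v \<bullet> (v - y) + (F h - F v) \<bullet> (v - y) + e \<bullet> (v - z) + e \<bullet> (z - y)"
      by (simp add: g_def inner_simps)
    then have "2 * \<alpha> * (g \<bullet> (v - y)) = 2 * \<alpha> * (F v \<bullet> (v - y)) + 2 * (\<alpha> * ((F h - F v) \<bullet> (v - y)))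
        + 2 * (\<alpha> * (e \<bullet> (v - z))) + 2 * \<alpha> * (e \<bullet> (z - y))"
      by (simp only: distrib_left mult.assoc)
    moreover have "2 * \<alpha> * (\<mu> * (infdist v Y)\<^sup>2) \<le> 2 * \<alpha> * (F v \<bullet> (v - y))"
      using sharp[OF vU y(1)] \<alpha> by (intro mult_left_mono) auto
    moreover have "- (\<alpha> * ((F h - F v) \<bullet> (v - y))) \<le> 7 / 50 * a\<^sup>2 + 25 / 168 * r\<^sup>2"
    proof -
      have "- ((F h - F v) \<bullet> (v - y)) \<le> norm (F h - F v) * norm (v - y)"
        using Cauchy_Schwarz_ineq2[of "F h - F v" "v - y"] by linarith
      also have "\<dots> \<le> (L * r) * a"
        using norm_F_diff_le[OF hU vU] unfolding r_def a_def by (intro mult_right_mono) auto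
      finally have "\<alpha> * (- ((F h - F v) \<bullet> (v - y))) \<le> \<alpha> * ((L * r) * a)"
        using \<alpha> by (intro mult_left_mono) auto
      also have "\<dots> = l * r * a" by (simp add: l_def)
      also have "\<dots> \<le> 7 / 50 * a\<^sup>2 + 25 / 14 * (l\<^sup>2 * r\<^sup>2)"
      proof -
        have "0 \<le> 7 / 50 * (a - 25 / 7 * (l * r))\<^sup>2" by simp
        then show ?thesis by (simp add: power2_eq_square algebra_simps)
      qed
      also have "l\<^sup>2 * r\<^sup>2 \<le> 1 / 12 * r\<^sup>2" using l2 by (intro mult_right_mono) auto
      finally show ?thesis by simp
    qed
    moreover have "- (\<alpha> * (e \<bullet> (v - z))) \<le> \<alpha>\<^sup>2 * (norm e)\<^sup>2"
    proof -
      have "norm (v - z) \<le> \<alpha> * norm e"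
      proof -
        have "dist v z \<le> dist (u - \<alpha> *\<^sub>R g) (u - \<alpha> *\<^sub>R F h)"
          unfolding v_def z_def using U U_nonempty by (intro closest_point_lipschitz) auto
        then show ?thesis using \<alpha> by (simp add: dist_norm g_def scaleR_add_right)
      qed
      have "- (e \<bullet> (v - z)) \<le> norm e * norm (v - z)"
        using Cauchy_Schwarz_ineq2[of e "v - z"] by linarith
      also have "\<dots> \<le> norm e * (\<alpha> * norm e)"
        using \<open>norm (v - z) \<le> \<alpha> * norm e\<close> by (intro mult_left_mono) auto
      finally have "\<alpha> * (- (e \<bullet> (v - z))) \<le> \<alpha> * (norm e * (\<alpha> * norm e))"
        using \<alpha> by (intro mult_left_mono) auto
      then show ?thesis by (simp add: power2_eq_square algebra_simps)
    qed
    ultimately have "m * (infdist v Y)\<^sup>2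
        \<le> D - w\<^sup>2 + 25 / 84 * r\<^sup>2 + 2 * (\<alpha>\<^sup>2 * (norm e)\<^sup>2) - 2 * \<alpha> * (e \<bullet> (z - y))"
      unfolding m_def using da by (simp add: algebra_simps)
    then have "(infdist v Y)\<^sup>2
        \<le> (D - w\<^sup>2 + 25 / 84 * r\<^sup>2 + 2 * (\<alpha>\<^sup>2 * (norm e)\<^sup>2) - 2 * \<alpha> * (e \<bullet> (z - y))) / m"
      using m by (simp add: field_simps)
    then have A: "(infdist v Y)\<^sup>2 + r\<^sup>2 / 3
        \<le> (D - w\<^sup>2) / m + \<psi> * r\<^sup>2 + 2 / m * (\<alpha>\<^sup>2 * (norm e)\<^sup>2) - 2 * \<alpha> / m * (e \<bullet> (z - y))"
      by (simp add: \<psi>_def add_divide_distrib diff_divide_distrib algebra_simps)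
    have "c * r\<^sup>2 \<le> 5 / 12 * (w\<^sup>2 + p\<^sup>2 / 3) + 5 * \<alpha>\<^sup>2 * (norm (e - (g' - F h')))\<^sup>2"
    proof -
      define n where "n = norm (e - (g' - F h'))"
      have "norm ((h - v) + (v - u) - (h' - u)) \<le> r + w + p"
        unfolding r_def w_def p_def
        by (intro norm_triangle_ineq4[THEN order_trans] add_right_mono norm_triangle_ineq)
      then have hh: "norm (h - h') \<le> r + w + p" by simp
      have "norm (g - g') \<le> norm (F h - F h') + n"
      proof -
        have "g - g' = (F h - F h') + (e - (g' - F h'))" by (simp add: g_def)
        then show ?thesis unfolding n_def by (metis norm_triangle_ineq)
      qed
      also have "\<dots> \<le> L * (r + w + p) + n"
        using norm_F_diff_le[OF hU h'] mult_left_mono[OF hh, of L] L_pos by linarith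
      finally have "\<alpha> * norm (g - g') \<le> \<alpha> * (L * (r + w + p) + n)"
        using \<alpha> by (intro mult_left_mono) auto
      also have "\<dots> = l * r + l * (w + p) + \<alpha> * n" by (simp add: l_def algebra_simps)
      finally have "r \<le> l * r + l * (w + p) + \<alpha> * n" using P(2) by (simp add: r_def)
      moreover have "l * r \<le> 2887 / 10000 * r" using l r_nn by (intro mult_right_mono)
      ultimately have "7113 / 10000 * r \<le> l * (w + p) + \<alpha> * n" by linarith
      then have "(7113 / 10000 * r)\<^sup>2 \<le> (l * (w + p) + \<alpha> * n)\<^sup>2"
        using r_nn by (intro power_mono) auto
      also have "\<dots> \<le> 5 / 4 * (l * (w + p))\<^sup>2 + 5 * (\<alpha> * n)\<^sup>2"
        using power2_sum_le_weighted[of "1/4" "l * (w + p)" "\<alpha> * n"] by simp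
      finally have "c * r\<^sup>2 \<le> 5 / 4 * (l\<^sup>2 * (w + p)\<^sup>2) + 5 * (\<alpha>\<^sup>2 * n\<^sup>2)"
        unfolding c_def power_mult_distrib .
      \<comment> \<open>The weight 3 yields \<open>4 * (w\<^sup>2 + p\<^sup>2 / 3)\<close>, so that
        \<open>p\<close> enters in the proportion of the potential.\<close>
      moreover have "(w + p)\<^sup>2 \<le> 4 * w\<^sup>2 + 4 / 3 * p\<^sup>2"
        using power2_sum_le_weighted[of 3 w p] by simp
      then have "l\<^sup>2 * (w + p)\<^sup>2 \<le> 1 / 12 * (4 * w\<^sup>2 + 4 / 3 * p\<^sup>2)"
        using l2 by (intro mult_mono) auto
      ultimately show ?thesis unfolding n_def distrib_left by linarith
    qed
    then have "\<theta> * (c * r\<^sup>2) \<le> \<theta> * (5 / 12 * (w\<^sup>2 + p\<^sup>2 / 3) + 5 * \<alpha>\<^sup>2 * (norm (e - (g' - F h')))\<^sup>2)"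
      using \<theta> by (intro mult_left_mono) auto
    moreover have "\<theta> * (c * r\<^sup>2) = \<psi> * r\<^sup>2" using c_pos by (simp add: \<theta>_def)
    moreover have "\<theta> * (5 / 12 * (w\<^sup>2 + p\<^sup>2 / 3) + 5 * \<alpha>\<^sup>2 * (norm (e - (g' - F h')))\<^sup>2)
        = 5 / 12 * \<theta> * (w\<^sup>2 + p\<^sup>2 / 3) + 5 * \<theta> * (\<alpha>\<^sup>2 * (norm (e - (g' - F h')))\<^sup>2)"
      by (simp add: algebra_simps)
    moreover have "5 / 12 * \<theta> * (w\<^sup>2 + p\<^sup>2 / 3) \<le> 1 / m * (w\<^sup>2 + p\<^sup>2 / 3)"
      using \<theta>m by (intro mult_right_mono) auto
    moreover have "(norm (e - (g' - F h')))\<^sup>2 = (norm e)\<^sup>2 + (norm (g' - F h'))\<^sup>2 - 2 * (e \<bullet> (g' - F h'))"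
      unfolding power2_norm_eq_inner by (simp add: inner_simps inner_commute)
    then have "5 * \<theta> * (\<alpha>\<^sup>2 * (norm (e - (g' - F h')))\<^sup>2) = 5 * \<theta> * (\<alpha>\<^sup>2 * (norm e)\<^sup>2)
        + 5 * \<theta> * (\<alpha>\<^sup>2 * (norm (g' - F h'))\<^sup>2) - 10 * \<theta> * \<alpha>\<^sup>2 * (e \<bullet> (g' - F h'))"
      by (simp only: ring_distribs)
    moreover have "e \<bullet> b = - (2 * \<alpha> / m * (e \<bullet> (z - y))) - 10 * \<theta> * \<alpha>\<^sup>2 * (e \<bullet> (g' - F h'))"
      by (simp only: b_def inner_diff_right inner_scaleR_right mult_minus_left)
    ultimately have "(infdist v Y)\<^sup>2 + r\<^sup>2 / 3
        \<le> (D - w\<^sup>2) / m + 1 / m * (w\<^sup>2 + p\<^sup>2 / 3) + (2 / m + 5 * \<theta>) * (\<alpha>\<^sup>2 * (norm e)\<^sup>2)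
          + 5 * \<theta> * (\<alpha>\<^sup>2 * (norm (g' - F h'))\<^sup>2) + e \<bullet> b"
      using A unfolding distrib_right by linarith
    also have "(D - w\<^sup>2) / m + 1 / m * (w\<^sup>2 + p\<^sup>2 / 3) = 1 / m * (D + p\<^sup>2 / 3)"
      by (simp add: add_divide_distrib diff_divide_distrib)
    also have "1 / m * (D + p\<^sup>2 / 3) \<le> exp (- (\<mu> * \<alpha>)) * (D + p\<^sup>2 / 3)"
    proof (intro mult_right_mono)
      have "exp (\<mu> * \<alpha>) \<le> m" unfolding m_def using t by (intro exp_le_chord)
      then show "1 / m \<le> exp (- (\<mu> * \<alpha>))" using m by (simp add: exp_minus field_simps)
    qed (use D_nn in auto)
    also have "(2 / m + 5 * \<theta>) * (\<alpha>\<^sup>2 * (norm e)\<^sup>2) \<le> 7 * (\<alpha>\<^sup>2 * (norm e)\<^sup>2)"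
    proof (intro mult_right_mono)
      have "2 / m \<le> 2 / (71 / 50)" using m by (intro divide_left_mono) auto
      then show "2 / m + 5 * \<theta> \<le> 7" using \<theta> by simp
    qed auto
    also have "5 * \<theta> * (\<alpha>\<^sup>2 * (norm (g' - F h'))\<^sup>2) \<le> 11 * (\<alpha>\<^sup>2 * (norm (g' - F h'))\<^sup>2)"
      using \<theta> by (intro mult_right_mono) auto
    finally show ?thesis
      unfolding popov_potential_def v_def[symmetric, unfolded g_def] r_def D_def p_def
      by (simp add: algebra_simps)
  qed
  then show ?thesis by blast
qed

lemma popov_step:
  assumes h: "h = closest_point U (u - \<alpha> *\<^sub>R g')" and h': "h' \<in> U"
    and \<alpha>: "\<alpha> > 0" "12 * (\<alpha> * L)\<^sup>2 \<le> 1" "\<mu> * \<alpha> \<le> 1"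
  shows "\<exists>b. \<forall>e. popov_potential Y (closest_point U (u - \<alpha> *\<^sub>R (F h + e))) h
      \<le> exp (- (\<mu> * \<alpha>)) * popov_potential Y u h'
        + \<alpha>\<^sup>2 * (7 * (norm e)\<^sup>2 + 11 * (norm (g' - F h'))\<^sup>2) + e \<bullet> b"
  using popov_step_short[OF assms(1-4)] popov_step_long[OF assms(1-4) _ assms(5)]
  by (cases "\<mu> * \<alpha> \<le> 7 / 20") auto

end

section \<open>The stepsize recursion\<close>

lemma exp_minus_le_inverse:
  assumes "t \<ge> (0::real)"
  shows "exp (- t) \<le> 1 / (1 + t)"
  using exp_ge_add_one_self[of t] assms by (simp add: exp_minus field_simps)

text \<open>Constant steps contract \<open>r\<close> while the noise stays below a fixed level;
  decreasing steps then shrink the noise like \<open>1 / n\<close>. Working in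
  \<open>ennreal\<close> spares integrability proofs for the later iterates.\<close>

lemma stepsize_recursion_bound:
  fixes R :: "nat \<Rightarrow> ennreal" and a d r v :: real
  assumes a: "0 < a" "a \<le> d" and K: "2 \<le> K" and v: "0 \<le> v" and r: "0 \<le> r"
    and start: "R 1 \<le> ennreal r"
    and step: "\<And>k. 1 \<le> k \<Longrightarrow> k \<le> K \<Longrightarrow>
      R (Suc k) \<le> ennreal (exp (- (a * stepsize_rule a d K k))) * R k
        + ennreal (18 * (stepsize_rule a d K k)\<^sup>2 * v)"
  shows "R (K + 1) \<le> ennreal (32 * d / a * r * exp (- (a * (real K - 1) / (2 * d)))
    + 432 * v / (a\<^sup>2 * (real K - 1)))"
proof -
  have d: "d > 0" using a by simp
  define k0 where "k0 = nat \<lceil>real K / 2\<rceil>"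
  have k0: "real K \<le> 2 * real k0" "2 * real k0 \<le> real K + 1" "1 \<le> k0" "k0 \<le> K"
  proof -
    have "K \<le> 2 * ((K + 1) div 2)" "2 * ((K + 1) div 2) \<le> K + 1" by linarith+
    then have div: "real K \<le> 2 * real ((K + 1) div 2)" "2 * real ((K + 1) div 2) \<le> real K + 1"
      by linarith+
    then have "\<lceil>real K / 2\<rceil> = int ((K + 1) div 2)" by (intro ceiling_unique) auto
    then have "k0 = (K + 1) div 2" by (simp add: k0_def)
    then show "real K \<le> 2 * real k0" "2 * real k0 \<le> real K + 1" "1 \<le> k0" "k0 \<le> K"
      using div K by auto
  qed
  have bound_step: "R (Suc k) \<le> ennreal b'"
    if "1 \<le> k" "k \<le> K" "R k \<le> ennreal b" "stepsize_rule a d K k = \<alpha>" "0 \<le> b"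
      "exp (- (a * \<alpha>)) * b + 18 * \<alpha>\<^sup>2 * v \<le> b'" for k b b' \<alpha>
  proof -
    have "R (Suc k) \<le> ennreal (exp (- (a * \<alpha>))) * ennreal b + ennreal (18 * \<alpha>\<^sup>2 * v)"
      using step[OF that(1,2)] that(3) unfolding that(4)
      by (meson add_right_mono mult_left_mono order_trans zero_le)
    also have "\<dots> = ennreal (exp (- (a * \<alpha>)) * b + 18 * \<alpha>\<^sup>2 * v)"
      using v that(5) by (simp add: ennreal_mult ennreal_plus)
    also have "\<dots> \<le> ennreal b'" using that(6) by (intro ennreal_leI)
    finally show ?thesis .
  qed
  define t where "t = a / d"
  have t: "0 < t" "t \<le> 1" using a d by (auto simp: t_def)
  have const_phase: "R (Suc k) \<le> ennreal (exp (- (t * k)) * r + 36 * v / (a * d))"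
    if "\<And>i. 1 \<le> i \<Longrightarrow> i \<le> k \<Longrightarrow> i \<le> K \<and> stepsize_rule a d K i = 1 / d" for k
    using that
  proof (induction k)
    case 0
    have "R (Suc 0) \<le> ennreal r" using start by simp
    also have "\<dots> \<le> ennreal (r + 36 * v / (a * d))" using v a d by (intro ennreal_leI) simp
    finally show ?case by simp
  next
    case (Suc k)
    define w where "w = 36 * v / (a * d)"
    have c: "w \<ge> 0" using v a d by (simp add: w_def)
    show ?case unfolding w_def[symmetric]
    proof (rule bound_step)
      show "1 \<le> Suc k" "Suc k \<le> K" "stepsize_rule a d K (Suc k) = 1 / d"
        using Suc.prems[of "Suc k"] by auto
      show "R (Suc k) \<le> ennreal (exp (- (t * k)) * r + w)"
        unfolding w_def using Suc.prems by (intro Suc.IH) auto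
      show "0 \<le> exp (- (t * real k)) * r + w" using r c by simp
      \<comment> \<open>The level \<open>w\<close> is chosen so that \<open>t / 2 * w\<close> is
        exactly the added noise \<open>18 * (1 / d)\<^sup>2 * v\<close>.\<close>
      have "exp (- t) * w \<le> 1 / (1 + t) * w"
        using c t exp_minus_le_inverse[of t] by (intro mult_right_mono) auto
      also have "1 / (1 + t) * w \<le> (1 - t / 2) * w"
      proof (intro mult_right_mono c)
        have "t * t \<le> t * 1" using t by (intro mult_left_mono) auto
        then show "1 / (1 + t) \<le> 1 - t / 2" using t by (simp add: field_simps)
      qed
      also have "\<dots> = w - 18 * (1 / d)\<^sup>2 * v"
        using a d by (simp add: t_def w_def field_simps power2_eq_square)
      finally have "exp (- t) * w + 18 * (1 / d)\<^sup>2 * v \<le> w" by simp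
      moreover have "exp (- t) * (exp (- (t * real k)) * r) = exp (- (t * real (Suc k))) * r"
        by (simp add: mult_exp_exp flip: mult.assoc) (simp add: algebra_simps)
      moreover have "a * (1 / d) = t" by (simp add: t_def)
      ultimately show "exp (- (a * (1 / d))) * (exp (- (t * real k)) * r + w) + 18 * (1 / d)\<^sup>2 * v
          \<le> exp (- (t * real (Suc k))) * r + w"
        unfolding distrib_left by (simp only:)
    qed
  qed
  have K1: "real K - 1 > 0" using K by simp
  \<comment> \<open>For \<open>k \<ge> K / 2 - 1\<close> the exponent misses its target by at most
    \<open>t / 2 \<le> 1 / 2\<close>; the resulting factor 2 disappears in the 32.\<close>
  have r_term: "exp (- (t * real k)) * r \<le> 32 * d / a * r * exp (- (a * (real K - 1) / (2 * d)))"
    if "real K - 2 \<le> 2 * real k" for k :: nat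
  proof -
    have "- (t * real k) \<le> 1 / 2 + - (a * (real K - 1) / (2 * d))"
    proof -
      have "t * (real K - 2 * real k - 1) \<le> 1 * 1"
      proof (cases "real K - 2 * real k - 1 \<ge> 0")
        case True
        then show ?thesis using t that by (intro mult_mono) auto
      next
        case False
        then have "t * (real K - 2 * real k - 1) \<le> 0" using t by (simp add: mult_nonneg_nonpos)
        then show ?thesis by simp
      qed
      moreover have "a * (real K - 1) / (2 * d) = t * (real K - 1) / 2" by (simp add: t_def)
      ultimately show ?thesis by (simp add: algebra_simps)
    qed
    then have "exp (- (t * real k)) \<le> exp (1 / 2 + - (a * (real K - 1) / (2 * d)))" by simp
    also have "\<dots> \<le> 32 * exp (- (a * (real K - 1) / (2 * d)))"
    proof -
      have "exp (1 / 2 :: real) \<le> 2" using exp_half_le2 .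
      then show ?thesis unfolding exp_add by (intro mult_right_mono) auto
    qed
    also have "\<dots> \<le> 32 * d / a * exp (- (a * (real K - 1) / (2 * d)))"
      using a by (intro mult_right_mono) (auto simp: field_simps)
    finally have "exp (- (t * real k)) * r \<le> 32 * d / a * exp (- (a * (real K - 1) / (2 * d))) * r"
      using r by (intro mult_right_mono)
    then show ?thesis by (simp add: mult_ac)
  qed
  show ?thesis
  proof (cases "real K \<le> d / a")
    case True
    then have "R (Suc K) \<le> ennreal (exp (- (t * K)) * r + 36 * v / (a * d))"
      by (intro const_phase) (auto simp: stepsize_rule_def)
    also have "\<dots> \<le> ennreal (32 * d / a * r * exp (- (a * (real K - 1) / (2 * d)))
        + 432 * v / (a\<^sup>2 * (real K - 1)))"
    proof (intro ennreal_leI add_mono r_term)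
      \<comment> \<open>Since 432 = 12 * 36, this suffices; \<open>K \<le> d / a\<close> gives it
        with room.\<close>
      have "a * (real K - 1) \<le> 12 * d" using True a by (simp add: field_simps)
      then have "a * (a * (real K - 1)) \<le> a * (12 * d)" using a by (intro mult_left_mono) auto
      then have "36 * v / (12 * (a * d)) \<le> 36 * v / (a\<^sup>2 * (real K - 1))"
        using a d K1 v by (intro divide_left_mono) (auto simp: power2_eq_square mult_ac)
      then show "36 * v / (a * d) \<le> 432 * v / (a\<^sup>2 * (real K - 1))" by simp
    qed simp
    finally show ?thesis by simp
  next
    case False
    have rule_decr: "stepsize_rule a d K (k0 + j) = 2 / (a * (2 * d / a + j))" for j
      unfolding stepsize_rule_def Let_def k0_def[symmetric] using False by simp
    define B where "B = exp (- (t * real (k0 - 1))) * r"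
    have B: "B \<ge> 0" using r by (simp add: B_def)
    have da: "2 \<le> 2 * d / a" using a by (simp add: field_simps)
    have decr_phase: "R (k0 + j) \<le> ennreal (B + 216 * v / (a\<^sup>2 * (2 * d / a + j)))"
      if "k0 + j \<le> K + 1" for j
      using that
    proof (induction j)
      case 0
      have "R (Suc (k0 - 1)) \<le> ennreal (B + 36 * v / (a * d))"
        unfolding B_def using False k0
        by (intro const_phase) (auto simp: stepsize_rule_def Let_def simp flip: k0_def)
      \<comment> \<open>108 = 216 / 2 is what the decreasing bound prescribes at
        \<open>j = 0\<close>.\<close>
      also have "\<dots> \<le> ennreal (B + 108 * v / (a * d))"
        using v a d by (intro ennreal_leI add_left_mono divide_right_mono) auto
      also have "108 * v / (a * d) = 216 * v / (a\<^sup>2 * (2 * d / a))"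
        using a by (simp add: power2_eq_square)
      finally show ?case using k0 by simp
    next
      case (Suc j)
      define n where "n = 2 * d / a + real j"
      have n: "2 \<le> n" using da by (simp add: n_def)
      define c where "c = 216 * v / a\<^sup>2"
      have c: "c \<ge> 0" using v by (simp add: c_def)
      have c_div: "216 * v / (a\<^sup>2 * x) = c / x" for x by (simp add: c_def)
      have "R (Suc (k0 + j)) \<le> ennreal (B + c / (n + 1))"
      proof (rule bound_step)
        show "1 \<le> k0 + j" "k0 + j \<le> K" using Suc.prems k0 by auto
        show "stepsize_rule a d K (k0 + j) = 2 / (a * n)" by (simp add: rule_decr n_def)
        show "R (k0 + j) \<le> ennreal (B + c / n)"
          using Suc.IH Suc.prems by (simp add: n_def c_div)
        show "0 \<le> B + c / n" using B c n by simp
        have "a * (2 / (a * n)) = 2 / n" using a by simp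
        \<comment> \<open>The initial error has decayed in the constant phase, so its further
          contraction is dropped.\<close>
        moreover have "exp (- (2 / n)) * B \<le> 1 * B" using n B by (intro mult_right_mono) auto
        moreover have "exp (- (2 / n)) * (c / n) \<le> 1 / (1 + 2 / n) * (c / n)"
          using n c exp_minus_le_inverse[of "2 / n"] by (intro mult_right_mono) auto
        moreover have "1 / (1 + 2 / n) * (c / n) = c * (1 / (n + 2))"
          using n by (simp add: field_simps)
        moreover have "18 * (2 / (a * n))\<^sup>2 * v = c * (1 / (3 * n\<^sup>2))"
          using a n by (simp add: c_def field_simps)
        \<comment> \<open>Origin of 216: one step adds noise \<open>c / (3 * n\<^sup>2)\<close>, the
          gap to fill is \<open>c / ((n + 1) * (n + 2))\<close>, and the comparison amounts to
          \<open>(n - 2) * (2 * n + 1) \<ge> 0\<close>. Here \<open>n \<ge> 2\<close> comes from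
          \<open>a \<le> d\<close>.\<close>
        moreover have "c * (1 / (n + 2)) + c * (1 / (3 * n\<^sup>2)) \<le> c * (1 / (n + 1))"
        proof -
          have "0 \<le> (n - 2) * (2 * n + 1)" using n by (intro mult_nonneg_nonneg) auto
          then have "(n + 1) * (n + 2) \<le> 3 * n\<^sup>2"
            by (simp add: power2_eq_square algebra_simps)
          then have "1 / (3 * n\<^sup>2) \<le> 1 / ((n + 1) * (n + 2))"
            using n by (intro divide_left_mono) auto
          also have "\<dots> = 1 / (n + 1) - 1 / (n + 2)" using n by (simp add: field_simps)
          finally have "c * (1 / (n + 2) + 1 / (3 * n\<^sup>2)) \<le> c * (1 / (n + 1))"
            using c by (intro mult_left_mono) auto
          then show ?thesis by (simp only: distrib_left)
        qed
        moreover have "c * (1 / (n + 1)) = c / (n + 1)" by simp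
        ultimately show "exp (- (a * (2 / (a * n)))) * (B + c / n) + 18 * (2 / (a * n))\<^sup>2 * v
            \<le> B + c / (n + 1)"
          unfolding distrib_left by (simp only:)
      qed
      then show ?case by (simp add: n_def c_div add_ac)
    qed
    define J where "J = K + 1 - k0"
    have J: "k0 + J = K + 1" using k0 by (simp add: J_def)
    have "R (K + 1) \<le> ennreal (B + 216 * v / (a\<^sup>2 * (2 * d / a + J)))"
      using decr_phase[of J] J by simp
    also have "\<dots> \<le> ennreal (32 * d / a * r * exp (- (a * (real K - 1) / (2 * d)))
        + 432 * v / (a\<^sup>2 * (real K - 1)))"
      unfolding B_def
    proof (intro ennreal_leI add_mono r_term)
      show "real K - 2 \<le> 2 * real (k0 - 1)" using k0 by (simp add: of_nat_diff)
      \<comment> \<open>At least half of the steps belong to the decreasing phase, which turns 216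
        into 432.\<close>
      have "real k0 + real J = real K + 1" using arg_cong[OF J, of real] by simp
      then have "real K - 1 \<le> 2 * real J" using k0(2) by linarith
      also have "\<dots> \<le> 2 * (2 * d / a + J)" using da by (intro mult_left_mono) auto
      finally have "real K - 1 \<le> 2 * (2 * d / a + J)" .
      then have "a\<^sup>2 * (real K - 1) \<le> a\<^sup>2 * (2 * (2 * d / a + J))" by (intro mult_left_mono) auto
      then have "432 * v / (a\<^sup>2 * (2 * (2 * d / a + J))) \<le> 432 * v / (a\<^sup>2 * (real K - 1))"
        using a d K1 v by (intro divide_left_mono mult_pos_pos add_pos_nonneg) auto
      moreover have "432 * v / (a\<^sup>2 * (2 * x)) = 216 * v / (a\<^sup>2 * x)" for x by simp
      ultimately show "216 * v / (a\<^sup>2 * (2 * d / a + J)) \<le> 432 * v / (a\<^sup>2 * (real K - 1))"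
        by (simp only:)
    qed
    finally show ?thesis .
  qed
qed

lemma stepsize_rule_le:
  assumes "0 < a" "0 < d"
  shows "stepsize_rule a d K k \<le> 1 / d"
proof -
  define k0 where "k0 = nat \<lceil>real K / 2\<rceil>"
  have "2 / (a * (2 * d / a + (real k - real k0))) \<le> 1 / d" if "k0 \<le> k"
  proof -
    have "2 * d \<le> a * (2 * d / a + (real k - real k0))"
      using assms that by (simp add: distrib_left)
    then have "2 / (a * (2 * d / a + (real k - real k0))) \<le> 2 / (2 * d)"
      using assms by (intro divide_left_mono) (auto intro!: mult_pos_pos simp del: zero_less_mult_iff)
    then show ?thesis by simp
  qed
  then show ?thesis unfolding stepsize_rule_def Let_def k0_def[symmetric] by (simp add: add_diff_eq)
qed

section \<open>Integrating out the last sample\<close>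

lemma (in prob_space) nn_integral_indep_var:
  assumes ind: "indep_var S X T Y" and f: "f \<in> borel_measurable (S \<Otimes>\<^sub>M T)"
  shows "(\<integral>\<^sup>+\<omega>. f (X \<omega>, Y \<omega>) \<partial>M) = (\<integral>\<^sup>+\<omega>. (\<integral>\<^sup>+\<omega>'. f (X \<omega>, Y \<omega>') \<partial>M) \<partial>M)"
proof -
  note rv = indep_var_rv1[OF ind] indep_var_rv2[OF ind]
  interpret Y: prob_space "distr M T Y" using rv by (intro prob_space_distr)
  have f': "f \<in> borel_measurable (distr M S X \<Otimes>\<^sub>M distr M T Y)"
    using f by (simp cong: measurable_cong_sets sets_pair_measure_cong)
  have "(\<integral>\<^sup>+\<omega>. f (X \<omega>, Y \<omega>) \<partial>M) = (\<integral>\<^sup>+z. f z \<partial>distr M (S \<Otimes>\<^sub>M T) (\<lambda>\<omega>. (X \<omega>, Y \<omega>)))"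
    using rv f by (subst nn_integral_distr) auto
  also have "\<dots> = (\<integral>\<^sup>+z. f z \<partial>(distr M S X \<Otimes>\<^sub>M distr M T Y))"
    using ind by (simp add: indep_var_distribution_eq)
  also have "\<dots> = (\<integral>\<^sup>+x. (\<integral>\<^sup>+s. f (x, s) \<partial>distr M T Y) \<partial>distr M S X)"
    using f' by (rule Y.nn_integral_fst[symmetric])
  also have "\<dots> = (\<integral>\<^sup>+\<omega>. (\<integral>\<^sup>+s. f (X \<omega>, s) \<partial>distr M T Y) \<partial>M)"
    using rv f by (intro nn_integral_distr) (auto intro!: Y.borel_measurable_nn_integral)
  also have "\<dots> = (\<integral>\<^sup>+\<omega>. (\<integral>\<^sup>+\<omega>'. f (X \<omega>, Y \<omega>') \<partial>M) \<partial>M)"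
    using rv f by (intro nn_integral_cong nn_integral_distr) (auto intro: measurable_compose_Pair1 measurable_space)
  finally show ?thesis .
qed

text \<open>Centring removes \<open>X \<omega> \<bullet> b\<close>. An infinite second moment makes
  the right side infinite, as \<open>0 < c\<close>; this case must be allowed, because the variance
  bound is available only after averaging over the past, not for each frozen past.\<close>

lemma (in prob_space) nn_integral_le_centred_quadratic:
  fixes X :: "'a \<Rightarrow> 'b::euclidean_space" and g :: "'a \<Rightarrow> real"
  assumes X: "has_bochner_integral M X 0" and g: "g \<in> borel_measurable M" "\<And>\<omega>. 0 \<le> g \<omega>"
    and c: "0 < c" and A: "0 \<le> A"
    and le: "\<And>\<omega>. g \<omega> \<le> A + c * (norm (X \<omega>))\<^sup>2 + X \<omega> \<bullet> b"
  shows "(\<integral>\<^sup>+\<omega>. g \<omega> \<partial>M) \<le> ennreal A + ennreal c * (\<integral>\<^sup>+\<omega>. (norm (X \<omega>))\<^sup>2 \<partial>M)"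
proof (cases "(\<integral>\<^sup>+\<omega>. (norm (X \<omega>))\<^sup>2 \<partial>M) = \<infinity>")
  case True
  then show ?thesis using c by (simp add: ennreal_mult_top)
next
  case False
  have Xm: "X \<in> borel_measurable M" and Xi: "integrable M X"
    using X by (auto simp: has_bochner_integral_iff)
  have sq: "integrable M (\<lambda>\<omega>. (norm (X \<omega>))\<^sup>2)"
    using Xm False by (intro integrableI_nonneg) (auto simp: less_top)
  have lin: "has_bochner_integral M (\<lambda>\<omega>. X \<omega> \<bullet> b) 0"
    using has_bochner_integral_inner_left[OF X, of b] by simp
  let ?q = "\<lambda>\<omega>. A + c * (norm (X \<omega>))\<^sup>2 + X \<omega> \<bullet> b"
  have q: "integrable M ?q" using sq lin by (auto simp: has_bochner_integral_iff)
  have "(\<integral>\<^sup>+\<omega>. g \<omega> \<partial>M) \<le> (\<integral>\<^sup>+\<omega>. ?q \<omega> \<partial>M)"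
    using le by (intro nn_integral_mono ennreal_leI) auto
  also have "\<dots> = ennreal (\<integral>\<omega>. ?q \<omega> \<partial>M)"
    using q le g(2) by (intro nn_integral_eq_integral AE_I2) (auto intro: order_trans)
  also have "(\<integral>\<omega>. ?q \<omega> \<partial>M) = A + c * (\<integral>\<omega>. (norm (X \<omega>))\<^sup>2 \<partial>M)"
    using sq lin by (simp add: has_bochner_integral_iff prob_space)
  also have "ennreal \<dots> = ennreal A + ennreal c * ennreal (\<integral>\<omega>. (norm (X \<omega>))\<^sup>2 \<partial>M)"
    using A c by (simp add: ennreal_plus ennreal_mult)
  also have "ennreal (\<integral>\<omega>. (norm (X \<omega>))\<^sup>2 \<partial>M) = (\<integral>\<^sup>+\<omega>. (norm (X \<omega>))\<^sup>2 \<partial>M)"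
    using sq by (intro nn_integral_eq_integral[symmetric]) auto
  finally show ?thesis .
qed

section \<open>Measurability of the iterates\<close>

text \<open>Allows the iterates to be read as functions of the finite vector of past samples, with
  the coordinate maps in the role of \<open>\<xi>\<close>.\<close>

lemma popov_cong:
  assumes "\<And>i. i < k \<Longrightarrow> \<xi> i \<omega> = \<xi>' i \<omega>'"
  shows "popov_u U \<Phi> \<alpha> u0 h0 \<xi> k \<omega> = popov_u U \<Phi> \<alpha> u0 h0 \<xi>' k \<omega>'
    \<and> popov_h U \<Phi> \<alpha> u0 h0 \<xi> k \<omega> = popov_h U \<Phi> \<alpha> u0 h0 \<xi>' k \<omega>'"
  using assms by (induction k) auto

lemma popov_in_set:
  assumes "closed U" "u0 \<in> U" "h0 \<in> U"
  shows "popov_u U \<Phi> \<alpha> u0 h0 \<xi> k \<omega> \<in> U" "popov_h U \<Phi> \<alpha> u0 h0 \<xi> k \<omega> \<in> U"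
  using assms by (cases k; auto intro!: closest_point_in_set)+

lemma borel_measurable_closest_point:
  fixes U :: "'a::euclidean_space set"
  assumes "convex U" "closed U" "U \<noteq> {}"
  shows "closest_point U \<in> borel_measurable borel"
  using continuous_on_closest_point[OF assms, of UNIV] by (intro borel_measurable_continuous_onI)

lemma measurable_comp_restrict_space:
  fixes U :: "'a::euclidean_space set" and \<Phi> :: "'a \<Rightarrow> 's::topological_space \<Rightarrow> 'b::topological_space"
  assumes \<Phi>: "(\<lambda>(v, s). \<Phi> v s) \<in> borel_measurable (restrict_space borel U \<Otimes>\<^sub>M borel)"
    and X: "X \<in> borel_measurable N" and Y: "Y \<in> borel_measurable N" and in_U: "\<And>\<omega>. X \<omega> \<in> U"
  shows "(\<lambda>\<omega>. \<Phi> (X \<omega>) (Y \<omega>)) \<in> borel_measurable N"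
proof -
  have "X \<in> N \<rightarrow>\<^sub>M restrict_space borel U"
    using X in_U by (intro measurable_restrict_space2) auto
  then have "(\<lambda>\<omega>. (X \<omega>, Y \<omega>)) \<in> N \<rightarrow>\<^sub>M restrict_space borel U \<Otimes>\<^sub>M borel"
    using Y by measurable
  from measurable_compose[OF this \<Phi>] show ?thesis by simp
qed

text \<open>\<open>N\<close> is arbitrary because this is applied both to the probability space and
  to the product space of the first \<open>k\<close> samples.\<close>

lemma borel_measurable_popov:
  fixes U :: "'a::euclidean_space set" and \<Phi> :: "'a \<Rightarrow> 's::topological_space \<Rightarrow> 'a"
  assumes U: "convex U" "closed U" and init: "u0 \<in> U" "h0 \<in> U"
    and \<Phi>: "(\<lambda>(v, s). \<Phi> v s) \<in> borel_measurable (restrict_space borel U \<Otimes>\<^sub>M borel)"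
    and \<xi>: "\<And>i. i < k \<Longrightarrow> \<xi> i \<in> borel_measurable N"
  shows "popov_u U \<Phi> \<alpha> u0 h0 \<xi> k \<in> borel_measurable N \<and> popov_h U \<Phi> \<alpha> u0 h0 \<xi> k \<in> borel_measurable N"
  using \<xi>
proof (induction k)
  case 0
  have "popov_u U \<Phi> \<alpha> u0 h0 \<xi> 0 = (\<lambda>_. u0)" "popov_h U \<Phi> \<alpha> u0 h0 \<xi> 0 = (\<lambda>_. h0)"
    by auto
  then show ?case by simp
next
  case (Suc k)
  have U_nonempty: "U \<noteq> {}" using init by auto
  note IH = Suc.IH[OF Suc.prems, OF less_SucI]
  note [measurable] = IH[THEN conjunct1] IH[THEN conjunct2]
    measurable_compose[OF _ borel_measurable_closest_point[OF U U_nonempty], measurable]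
  have [measurable]: "(\<lambda>\<omega>. \<Phi> (popov_h U \<Phi> \<alpha> u0 h0 \<xi> k \<omega>) (\<xi> k \<omega>)) \<in> borel_measurable N"
    using Suc.prems IH popov_in_set[OF U(2) init]
    by (intro measurable_comp_restrict_space[OF \<Phi>]) auto
  have u: "popov_u U \<Phi> \<alpha> u0 h0 \<xi> (Suc k) \<in> borel_measurable N"
    unfolding popov_u.simps(2)[abs_def] by measurable
  note [measurable] = u
  have "popov_h U \<Phi> \<alpha> u0 h0 \<xi> (Suc k) \<in> borel_measurable N"
    unfolding popov_h.simps(2)[abs_def] by measurable
  with u show ?case by blast
qed

lemma borel_measurable_popov_potential [measurable (raw)]:
  fixes X Z :: "'w \<Rightarrow> 'a::euclidean_space"
  assumes [measurable]: "X \<in> borel_measurable N" "Z \<in> borel_measurable N"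
  shows "(\<lambda>\<omega>. popov_potential Y (X \<omega>) (Z \<omega>)) \<in> borel_measurable N"
proof -
  have "(\<lambda>x. infdist x Y) \<in> borel_measurable borel"
    by (intro borel_measurable_continuous_onI continuous_intros)
  note [measurable] = measurable_compose[OF _ this]
  show ?thesis unfolding popov_potential_def by measurable
qed

lemma popov_potential_nonneg: "0 \<le> popov_potential Y u h"
  by (simp add: popov_potential_def)

section \<open>One step of the method in expectation\<close>

locale stochastic_popov = prob_space M + quasi_sharp_vi U Y F L \<mu>
  for M :: "'w measure" and U Y :: "'a::euclidean_space set" and F :: "'a \<Rightarrow> 'a" and L \<mu> :: real +
  fixes \<Phi> :: "'a \<Rightarrow> 's::topological_space \<Rightarrow> 'a" and N :: "'s measure" and \<xi>s :: "nat \<Rightarrow> 'w \<Rightarrow> 's"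
    and \<alpha> :: "nat \<Rightarrow> real" and u0 h0 :: 'a
  assumes \<Phi>_measurable: "(\<lambda>(v, s). \<Phi> v s) \<in> borel_measurable (restrict_space borel U \<Otimes>\<^sub>M borel)"
    and mean: "\<And>v. v \<in> U \<Longrightarrow> has_bochner_integral N (\<Phi> v) (F v)"
    and indep: "indep_vars (\<lambda>_. borel) \<xi>s UNIV"
    and distr: "\<And>k. distr M borel (\<xi>s k) = N"
    and init: "u0 \<in> U" "h0 \<in> U"
    and \<alpha>_pos: "\<And>k. \<alpha> k > 0"
begin

abbreviation u where "u \<equiv> popov_u U \<Phi> \<alpha> u0 h0 \<xi>s"
abbreviation h where "h \<equiv> popov_h U \<Phi> \<alpha> u0 h0 \<xi>s"

definition noise :: "nat \<Rightarrow> 'w \<Rightarrow> 'a" where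
  "noise k \<omega> = \<Phi> (h k \<omega>) (\<xi>s k \<omega>) - F (h k \<omega>)"

lemma \<xi>s_measurable [measurable]: "\<xi>s k \<in> borel_measurable M"
  using indep by (auto simp: indep_vars_def)

lemma prob_space_N: "prob_space N"
  using distr[of 0] by (metis \<xi>s_measurable prob_space_distr)

lemma sets_N [measurable_cong]: "sets N = sets borel"
  using distr[of 0] by auto

lemma u_measurable [measurable]: "u k \<in> borel_measurable M"
  and h_measurable [measurable]: "h k \<in> borel_measurable M"
  using borel_measurable_popov[OF U init \<Phi>_measurable, of k \<xi>s M] by auto

lemma h_in_U: "h k \<omega> \<in> U"
  by (rule popov_in_set[OF U(2) init])

lemma F_measurable: "F \<in> borel_measurable (restrict_space borel U)"
  using lipschitz_on_continuous_on[OF lipschitz] by (rule borel_measurable_continuous_on_restrict)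

lemma noise_measurable [measurable]: "noise k \<in> borel_measurable M"
proof -
  have "h k \<in> M \<rightarrow>\<^sub>M restrict_space borel U"
    using h_in_U by (intro measurable_restrict_space2) auto
  from measurable_compose[OF this F_measurable]
  have [measurable]: "(\<lambda>\<omega>. F (h k \<omega>)) \<in> borel_measurable M" .
  have [measurable]: "(\<lambda>\<omega>. \<Phi> (h k \<omega>) (\<xi>s k \<omega>)) \<in> borel_measurable M"
    using h_in_U by (intro measurable_comp_restrict_space[OF \<Phi>_measurable]) auto
  show ?thesis unfolding noise_def[abs_def] by measurable
qed

text \<open>\<open>u k\<close> and \<open>h k\<close> are functions of the samples before
  \<open>k\<close>, which are independent of \<open>\<xi>s k\<close>. The hypothesis on
  \<open>G\<close> is phrased by substituting measurable maps, with \<open>Z\<close> valued in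
  \<open>U\<close>, because \<Phi> is measurable only over \<open>U\<close>.\<close>

lemma nn_integral_freeze:
  fixes G :: "'a \<Rightarrow> 'a \<Rightarrow> 's \<Rightarrow> ennreal"
  assumes G: "\<And>(A :: ((nat \<Rightarrow> 's) \<times> (nat \<Rightarrow> 's)) measure) X Z S. X \<in> borel_measurable A \<Longrightarrow>
      Z \<in> borel_measurable A \<Longrightarrow> S \<in> borel_measurable A \<Longrightarrow> (\<And>a. Z a \<in> U) \<Longrightarrow>
      (\<lambda>a. G (X a) (Z a) (S a)) \<in> borel_measurable A"
    and G': "\<And>x z. z \<in> U \<Longrightarrow> G x z \<in> borel_measurable borel"
  shows "(\<integral>\<^sup>+\<omega>. G (u k \<omega>) (h k \<omega>) (\<xi>s k \<omega>) \<partial>M) = (\<integral>\<^sup>+\<omega>. (\<integral>\<^sup>+s. G (u k \<omega>) (h k \<omega>) s \<partial>N) \<partial>M)"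
proof -
  let ?S = "PiM {..<k} (\<lambda>_. borel) :: (nat \<Rightarrow> 's) measure"
  let ?X = "\<lambda>\<omega>. restrict (\<lambda>i. \<xi>s i \<omega>) {..<k}"
  define pu where "pu = popov_u U \<Phi> \<alpha> u0 h0 (\<lambda>i x. x i) k"
  define ph where "ph = popov_h U \<Phi> \<alpha> u0 h0 (\<lambda>i x. x i) k"
  have uh: "u k \<omega> = pu (?X \<omega>)" "h k \<omega> = ph (?X \<omega>)" for \<omega>
    unfolding pu_def ph_def
    using popov_cong[of k \<xi>s \<omega> "\<lambda>i x. x i" "?X \<omega>" U \<Phi> \<alpha> u0 h0] by auto
  have ph_in: "ph x \<in> U" for x
    unfolding ph_def by (rule popov_in_set[OF U(2) init])
  have m: "pu \<in> borel_measurable ?S" "ph \<in> borel_measurable ?S"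
    using borel_measurable_popov[OF U init \<Phi>_measurable, of k "\<lambda>i x. x i" ?S \<alpha>]
    by (auto simp: pu_def ph_def)
  have ind: "indep_var ?S ?X (PiM {k} (\<lambda>_. borel)) (\<lambda>\<omega>. restrict (\<lambda>i. \<xi>s i \<omega>) {k})"
    by (intro indep_var_restrict[OF indep]) auto
  have meas: "(\<lambda>(x, y). G (pu x) (ph x) (y k)) \<in> borel_measurable (?S \<Otimes>\<^sub>M PiM {k} (\<lambda>_. borel))"
    unfolding case_prod_beta using m ph_in
    by (intro G) (auto intro: measurable_compose[OF measurable_fst] measurable_compose[OF measurable_snd])
  have "(\<integral>\<^sup>+\<omega>. G (u k \<omega>) (h k \<omega>) (\<xi>s k \<omega>) \<partial>M)
      = (\<integral>\<^sup>+\<omega>. (\<integral>\<^sup>+\<omega>'. G (u k \<omega>) (h k \<omega>) (\<xi>s k \<omega>') \<partial>M) \<partial>M)"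
    unfolding uh using nn_integral_indep_var[OF ind meas] by simp
  also have "\<dots> = (\<integral>\<^sup>+\<omega>. (\<integral>\<^sup>+s. G (u k \<omega>) (h k \<omega>) s \<partial>N) \<partial>M)"
    unfolding distr[of k, symmetric]
    by (intro nn_integral_cong nn_integral_distr[symmetric]) (auto intro!: G' h_in_U)
  finally show ?thesis .
qed

text \<open>Turns the second moment at a frozen past, left by integrating one step, back into the
  total noise moment that the variance hypothesis bounds.\<close>

lemma nn_integral_noise_freeze:
  "(\<integral>\<^sup>+\<omega>. (norm (noise k \<omega>))\<^sup>2 \<partial>M) = (\<integral>\<^sup>+\<omega>. (\<integral>\<^sup>+s. (norm (\<Phi> (h k \<omega>) s - F (h k \<omega>)))\<^sup>2 \<partial>N) \<partial>M)"
proof -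
  have G: "(\<lambda>a. ennreal ((norm (\<Phi> (Z a) (S a) - F (Z a)))\<^sup>2)) \<in> borel_measurable A"
    if "Z \<in> borel_measurable A" "\<And>a. Z a \<in> U" "S \<in> borel_measurable A"
    for A :: "'c measure" and Z and S :: "'c \<Rightarrow> 's"
  proof -
    have "Z \<in> A \<rightarrow>\<^sub>M restrict_space borel U"
      using that by (intro measurable_restrict_space2) auto
    from measurable_compose[OF this F_measurable]
    have [measurable]: "(\<lambda>a. F (Z a)) \<in> borel_measurable A" .
    have [measurable]: "(\<lambda>a. \<Phi> (Z a) (S a)) \<in> borel_measurable A"
      using that by (intro measurable_comp_restrict_space[OF \<Phi>_measurable]) auto
    show ?thesis by measurable
  qed
  show ?thesis unfolding noise_def
    by (rule nn_integral_freeze[where G = "\<lambda>_ z s. ennreal ((norm (\<Phi> z s - F z))\<^sup>2)"];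
        rule G; simp)
qed

text \<open>\<open>h (Suc j)\<close> was computed with the sample of step \<open>j\<close>, so both
  noises enter and 18 = 7 + 11. This is also why the recursion starts at index 1.\<close>

lemma expected_potential_step:
  assumes var: "\<And>k. (\<integral>\<^sup>+\<omega>. (norm (noise k \<omega>))\<^sup>2 \<partial>M) \<le> ennreal v" and v: "0 \<le> v"
    and \<alpha>: "12 * (\<alpha> (Suc j) * L)\<^sup>2 \<le> 1" "\<mu> * \<alpha> (Suc j) \<le> 1"
  shows "(\<integral>\<^sup>+\<omega>. popov_potential Y (u (Suc (Suc j)) \<omega>) (h (Suc j) \<omega>) \<partial>M)
    \<le> ennreal (exp (- (\<mu> * \<alpha> (Suc j)))) * (\<integral>\<^sup>+\<omega>. popov_potential Y (u (Suc j) \<omega>) (h j \<omega>) \<partial>M)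
      + ennreal (18 * (\<alpha> (Suc j))\<^sup>2 * v)"
proof -
  define k where "k = Suc j"
  define G where "G = (\<lambda>x z s. popov_potential Y (closest_point U (x - \<alpha> k *\<^sub>R \<Phi> z s)) z)"
  define \<phi> where "\<phi> = exp (- (\<mu> * \<alpha> k))"
  interpret N: prob_space N by (rule prob_space_N)
  note cp [measurable] = measurable_compose[OF _ borel_measurable_closest_point[OF U U_nonempty]]
  have G_measurable: "(\<lambda>a. G (X a) (Z a) (S a)) \<in> borel_measurable A"
    if [measurable]: "X \<in> borel_measurable A" "Z \<in> borel_measurable A" "S \<in> borel_measurable A"
      and Z: "\<And>a. Z a \<in> U" for A :: "'b measure" and X Z S
  proof -
    have [measurable]: "(\<lambda>a. \<Phi> (Z a) (S a)) \<in> borel_measurable A"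
      using Z by (intro measurable_comp_restrict_space[OF \<Phi>_measurable]) auto
    show ?thesis unfolding G_def by measurable
  qed
  \<comment> \<open>Here \<omega> fixes the past. The vector \<open>b\<close> may be picked anew for
    each \<omega>, since only the resulting inequality, free of \<open>b\<close>, is integrated
    later.\<close>
  have inner: "(\<integral>\<^sup>+s. G (u k \<omega>) (h k \<omega>) s \<partial>N)
      \<le> ennreal (\<phi> * popov_potential Y (u k \<omega>) (h j \<omega>) + (\<alpha> k)\<^sup>2 * 11 * (norm (noise j \<omega>))\<^sup>2)
        + ennreal (7 * (\<alpha> k)\<^sup>2) * (\<integral>\<^sup>+s. (norm (\<Phi> (h k \<omega>) s - F (h k \<omega>)))\<^sup>2 \<partial>N)" for \<omega>
  proof -
    have "h k \<omega> = closest_point U (u k \<omega> - \<alpha> k *\<^sub>R \<Phi> (h j \<omega>) (\<xi>s j \<omega>))"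
      unfolding k_def by (rule popov_h.simps(2))
    from popov_step[OF this h_in_U \<alpha>_pos \<alpha>[folded k_def]] obtain b where
      b: "\<And>e. popov_potential Y (closest_point U (u k \<omega> - \<alpha> k *\<^sub>R (F (h k \<omega>) + e))) (h k \<omega>)
        \<le> \<phi> * popov_potential Y (u k \<omega>) (h j \<omega>)
          + (\<alpha> k)\<^sup>2 * (7 * (norm e)\<^sup>2 + 11 * (norm (noise j \<omega>))\<^sup>2) + e \<bullet> b"
      unfolding noise_def \<phi>_def by blast
    have "has_bochner_integral N (\<lambda>s. \<Phi> (h k \<omega>) s - F (h k \<omega>)) (F (h k \<omega>) - F (h k \<omega>))"
    proof (rule has_bochner_integral_diff[OF mean[OF h_in_U]])
      show "has_bochner_integral N (\<lambda>s. F (h k \<omega>)) (F (h k \<omega>))"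
        using N.prob_space by (simp add: has_bochner_integral_iff)
    qed
    then have 0: "has_bochner_integral N (\<lambda>s. \<Phi> (h k \<omega>) s - F (h k \<omega>)) 0" by simp
    show ?thesis
    proof (rule N.nn_integral_le_centred_quadratic[OF 0, where b = b])
      show "(\<lambda>s. G (u k \<omega>) (h k \<omega>) s) \<in> borel_measurable N"
        using h_in_U by (intro G_measurable) auto
      show "0 \<le> G (u k \<omega>) (h k \<omega>) s" for s
        by (simp add: G_def popov_potential_nonneg)
      show "0 < 7 * (\<alpha> k)\<^sup>2" using \<alpha>_pos[of k] by simp
      show "0 \<le> \<phi> * popov_potential Y (u k \<omega>) (h j \<omega>) + (\<alpha> k)\<^sup>2 * 11 * (norm (noise j \<omega>))\<^sup>2"
        by (simp add: \<phi>_def popov_potential_nonneg)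
      show "G (u k \<omega>) (h k \<omega>) s
        \<le> \<phi> * popov_potential Y (u k \<omega>) (h j \<omega>) + (\<alpha> k)\<^sup>2 * 11 * (norm (noise j \<omega>))\<^sup>2
          + 7 * (\<alpha> k)\<^sup>2 * (norm (\<Phi> (h k \<omega>) s - F (h k \<omega>)))\<^sup>2 + (\<Phi> (h k \<omega>) s - F (h k \<omega>)) \<bullet> b" for s
        using b[of "\<Phi> (h k \<omega>) s - F (h k \<omega>)"] by (simp add: G_def distrib_left mult_ac)
    qed
  qed
  have [measurable]: "(\<lambda>\<omega>. \<integral>\<^sup>+s. (norm (\<Phi> (h k \<omega>) s - F (h k \<omega>)))\<^sup>2 \<partial>N) \<in> borel_measurable M"
  proof (rule N.borel_measurable_nn_integral)
    have "(\<lambda>p. h k (fst p)) \<in> M \<Otimes>\<^sub>M N \<rightarrow>\<^sub>M restrict_space borel U"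
      using h_in_U by (intro measurable_restrict_space2) auto
    from measurable_compose[OF this F_measurable]
    have [measurable]: "(\<lambda>p. F (h k (fst p))) \<in> borel_measurable (M \<Otimes>\<^sub>M N)" .
    have [measurable]: "(\<lambda>p. \<Phi> (h k (fst p)) (snd p)) \<in> borel_measurable (M \<Otimes>\<^sub>M N)"
      using h_in_U by (intro measurable_comp_restrict_space[OF \<Phi>_measurable]) measurable
    show "(\<lambda>(\<omega>, s). ennreal ((norm (\<Phi> (h k \<omega>) s - F (h k \<omega>)))\<^sup>2)) \<in> borel_measurable (M \<Otimes>\<^sub>M N)"
      unfolding case_prod_beta by measurable
  qed
  have "(\<integral>\<^sup>+\<omega>. popov_potential Y (u (Suc k) \<omega>) (h k \<omega>) \<partial>M) = (\<integral>\<^sup>+\<omega>. G (u k \<omega>) (h k \<omega>) (\<xi>s k \<omega>) \<partial>M)"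
    by (simp add: G_def)
  also have "\<dots> = (\<integral>\<^sup>+\<omega>. (\<integral>\<^sup>+s. G (u k \<omega>) (h k \<omega>) s \<partial>N) \<partial>M)"
    by (rule nn_integral_freeze[where G = "\<lambda>x z s. ennreal (G x z s)"];
        rule measurable_compose[OF _ measurable_ennreal]; rule G_measurable; simp)
  also have "\<dots> \<le> (\<integral>\<^sup>+\<omega>. ennreal \<phi> * popov_potential Y (u k \<omega>) (h j \<omega>)
      + ennreal (11 * (\<alpha> k)\<^sup>2) * (norm (noise j \<omega>))\<^sup>2
      + ennreal (7 * (\<alpha> k)\<^sup>2) * (\<integral>\<^sup>+s. (norm (\<Phi> (h k \<omega>) s - F (h k \<omega>)))\<^sup>2 \<partial>N) \<partial>M)"
    using inner
    by (intro nn_integral_mono)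
      (simp add: \<phi>_def popov_potential_nonneg ennreal_mult[symmetric] ennreal_plus[symmetric] mult_ac
        del: ennreal_plus)
  also have "\<dots> = ennreal \<phi> * (\<integral>\<^sup>+\<omega>. popov_potential Y (u k \<omega>) (h j \<omega>) \<partial>M)
      + ennreal (11 * (\<alpha> k)\<^sup>2) * (\<integral>\<^sup>+\<omega>. (norm (noise j \<omega>))\<^sup>2 \<partial>M)
      + ennreal (7 * (\<alpha> k)\<^sup>2) * (\<integral>\<^sup>+\<omega>. (norm (noise k \<omega>))\<^sup>2 \<partial>M)"
    unfolding nn_integral_noise_freeze[of k]
    by (subst nn_integral_add, measurable)+ (simp add: nn_integral_cmult)
  also have "\<dots> \<le> ennreal \<phi> * (\<integral>\<^sup>+\<omega>. popov_potential Y (u k \<omega>) (h j \<omega>) \<partial>M)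
      + ennreal (11 * (\<alpha> k)\<^sup>2) * ennreal v + ennreal (7 * (\<alpha> k)\<^sup>2) * ennreal v"
    using var by (intro add_mono mult_left_mono) auto
  also have "\<dots> = ennreal \<phi> * (\<integral>\<^sup>+\<omega>. popov_potential Y (u k \<omega>) (h j \<omega>) \<partial>M) + ennreal (18 * (\<alpha> k)\<^sup>2 * v)"
    using v by (simp add: add.assoc ennreal_mult[symmetric] ennreal_plus[symmetric] del: ennreal_plus)
  finally show ?thesis unfolding \<phi>_def k_def .
qed

text \<open>Guarantees that \<open>r1\<close> is the true value of its integral and not the default
  0 of a non-integrable function. Nonexpansiveness of the projection bounds
  \<open>u 1 \<omega> - z\<close>, for \<open>z\<close> in \<open>U\<close>, by a constant plus
  \<open>\<alpha> 0\<close> times the noise.\<close>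

lemma integrable_first_iterate:
  assumes var: "(\<integral>\<^sup>+\<omega>. (norm (noise 0 \<omega>))\<^sup>2 \<partial>M) \<le> ennreal v"
  shows "integrable M (\<lambda>\<omega>. (infdist (u 1 \<omega>) Y)\<^sup>2 + (norm (h0 - u 1 \<omega>))\<^sup>2)"
proof -
  have sq: "integrable M (\<lambda>\<omega>. (norm (noise 0 \<omega>))\<^sup>2)"
    using var by (intro integrableI_nonneg) (auto simp: le_less_trans)
  have bound: "(norm (u 1 \<omega> - z))\<^sup>2 \<le> 2 * (norm (u0 - \<alpha> 0 *\<^sub>R F h0 - z))\<^sup>2 + 2 * (\<alpha> 0)\<^sup>2 * (norm (noise 0 \<omega>))\<^sup>2"
    if "z \<in> U" for z \<omega>
  proof -
    have "dist (u 1 \<omega>) (closest_point U z) \<le> dist (u0 - \<alpha> 0 *\<^sub>R \<Phi> h0 (\<xi>s 0 \<omega>)) z"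
      using U U_nonempty by (simp add: closest_point_lipschitz)
    then have "norm (u 1 \<omega> - z) \<le> norm ((u0 - \<alpha> 0 *\<^sub>R F h0 - z) - \<alpha> 0 *\<^sub>R noise 0 \<omega>)"
      using closest_point_self[OF that] by (simp add: dist_norm noise_def algebra_simps)
    also have "\<dots> \<le> norm (u0 - \<alpha> 0 *\<^sub>R F h0 - z) + \<alpha> 0 * norm (noise 0 \<omega>)"
      using norm_triangle_ineq4[of "u0 - \<alpha> 0 *\<^sub>R F h0 - z" "\<alpha> 0 *\<^sub>R noise 0 \<omega>"] \<alpha>_pos[of 0] by simp
    finally have "(norm (u 1 \<omega> - z))\<^sup>2 \<le> (norm (u0 - \<alpha> 0 *\<^sub>R F h0 - z) + \<alpha> 0 * norm (noise 0 \<omega>))\<^sup>2"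
      by (intro power_mono) auto
    also have "\<dots> \<le> 2 * (norm (u0 - \<alpha> 0 *\<^sub>R F h0 - z))\<^sup>2 + 2 * (\<alpha> 0 * norm (noise 0 \<omega>))\<^sup>2"
      using power2_sum_le_weighted[of 1 "norm (u0 - \<alpha> 0 *\<^sub>R F h0 - z)" "\<alpha> 0 * norm (noise 0 \<omega>)"] by simp
    finally show ?thesis by (simp add: power_mult_distrib)
  qed
  have int: "integrable M (\<lambda>\<omega>. (norm (u 1 \<omega> - z))\<^sup>2)" if "z \<in> U" for z
  proof (rule Bochner_Integration.integrable_bound)
    show "integrable M (\<lambda>\<omega>. 2 * (norm (u0 - \<alpha> 0 *\<^sub>R F h0 - z))\<^sup>2 + 2 * (\<alpha> 0)\<^sup>2 * (norm (noise 0 \<omega>))\<^sup>2)"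
      using sq by simp
    show "AE \<omega> in M. norm ((norm (u 1 \<omega> - z))\<^sup>2)
        \<le> norm (2 * (norm (u0 - \<alpha> 0 *\<^sub>R F h0 - z))\<^sup>2 + 2 * (\<alpha> 0)\<^sup>2 * (norm (noise 0 \<omega>))\<^sup>2)"
      using bound[OF that] by (intro AE_I2) (auto intro: order_trans)
  qed measurable
  obtain y where y: "y \<in> Y" "y \<in> U" using Y by auto
  have "(\<lambda>x. infdist x Y) \<in> borel_measurable borel"
    by (intro borel_measurable_continuous_onI continuous_intros)
  note [measurable] = measurable_compose[OF _ this]
  have "integrable M (\<lambda>\<omega>. (infdist (u 1 \<omega>) Y)\<^sup>2)"
  proof (rule Bochner_Integration.integrable_bound[OF int[OF y(2)]])
    show "AE \<omega> in M. norm ((infdist (u 1 \<omega>) Y)\<^sup>2) \<le> norm ((norm (u 1 \<omega> - y))\<^sup>2)"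
      using infdist_le[OF y(1)] by (intro AE_I2) (auto simp: dist_norm infdist_nonneg intro!: power_mono)
  qed measurable
  with int[OF init(2)] show ?thesis by (simp add: norm_minus_commute[of h0])
qed

end

section \<open>From the conditional variance bound to the final estimate\<close>

text \<open>The defining property of the conditional expectation, tested with the constant
  1.\<close>

lemma (in prob_space) nn_integral_le_of_nonneg_cond_exp_le:
  assumes [measurable]: "X \<in> borel_measurable M" "W \<in> borel_measurable M"
    and le: "AE \<omega> in M. nonneg_cond_exp M X W \<omega> \<le> c"
  shows "(\<integral>\<^sup>+\<omega>. W \<omega> \<partial>M) \<le> c"
proof -
  have "subalgebra M (sigma_gen M X)"
    unfolding subalgebra_def by (auto simp: sets_vimage_algebra2)
  then interpret finite_measure_subalgebra M "sigma_gen M X"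
    by unfold_locales
  have "(\<integral>\<^sup>+\<omega>. W \<omega> \<partial>M) = (\<integral>\<^sup>+\<omega>. 1 * nonneg_cond_exp M X W \<omega> \<partial>M)"
    by (subst nn_cond_exp_intg) auto
  also have "\<dots> \<le> (\<integral>\<^sup>+\<omega>. c \<partial>M)"
    using le by (intro nn_integral_mono_AE) auto
  also have "\<dots> = c" by (simp add: emeasure_space_1)
  finally show ?thesis .
qed

theorem theorem3p7:
  fixes M :: "'w measure"
    and U :: "(real ^ 'm) set"
    and F :: "real ^ 'm \<Rightarrow> real ^ 'm"
    and \<Phi> :: "real ^ 'm \<Rightarrow> real ^ 'n \<Rightarrow> real ^ 'm"
    and \<xi> :: "'w \<Rightarrow> real ^ 'n"
    and \<xi>s :: "nat \<Rightarrow> 'w \<Rightarrow> real ^ 'n"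
    and \<alpha> :: "nat \<Rightarrow> real"
    and u0 h0 :: "real ^ 'm"
    and u h :: "nat \<Rightarrow> 'w \<Rightarrow> real ^ 'm"
    and \<sigma> L \<mu> d r1 :: real
    and K :: nat
    and Ustar :: "(real ^ 'm) set"
  assumes "prob_space M"
    and "U \<noteq> {}" and "closed U" and "convex U"
    and \<Phi>_measurable: "(\<lambda>(v, s). \<Phi> v s) \<in> borel_measurable (restrict_space borel U \<Otimes>\<^sub>M borel)"
    and \<xi>_measurable: "\<xi> \<in> borel_measurable M"
    and F_mean: "\<And>v. v \<in> U \<Longrightarrow> has_bochner_integral M (\<lambda>\<omega>. \<Phi> v (\<xi> \<omega>)) (F v)"
    and Ustar: "Ustar = VI_solutions U F" "Ustar \<noteq> {}" "closed Ustar"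
    and samples_indep: "prob_space.indep_vars M (\<lambda>_. borel) \<xi>s UNIV"
    and samples_distr: "\<And>k. distr M borel (\<xi>s k) = distr M borel \<xi>"
    and init: "u0 \<in> U" "h0 \<in> U"
    and u: "u = popov_u U \<Phi> \<alpha> u0 h0 \<xi>s"
    and h: "h = popov_h U \<Phi> \<alpha> u0 h0 \<xi>s"
    and "\<sigma> > 0"
    and unbiased: "\<And>k. AE \<omega> in M.
          vec_cond_exp M (h k) (\<lambda>\<omega>. \<Phi> (h k \<omega>) (\<xi>s k \<omega>) - F (h k \<omega>)) \<omega> = 0"
    and variance: "\<And>k. AE \<omega> in M.
          nonneg_cond_exp M (h k) (\<lambda>\<omega>. (norm (\<Phi> (h k \<omega>) (\<xi>s k \<omega>) - F (h k \<omega>)))\<^sup>2) \<omega>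
            \<le> ennreal (\<sigma>\<^sup>2)"
    and "L > 0" and lipschitz: "L-lipschitz_on U F"
    and "\<mu> > 0"
    and quasi_sharp: "\<And>v w. v \<in> U \<Longrightarrow> w \<in> Ustar \<Longrightarrow> F v \<bullet> (v - w) \<ge> \<mu> * (infdist v Ustar)\<^sup>2"
    and "K \<ge> 2"
    and d: "d \<ge> max (2 * sqrt 3 * L) \<mu>"
    and \<alpha>_pos: "\<And>k. \<alpha> k > 0"
    and \<alpha>_rule: "\<And>k. k \<le> K \<Longrightarrow> \<alpha> k = stepsize_rule \<mu> d K k"
    and r1: "r1 = prob_space.expectation M (\<lambda>\<omega>. (infdist (u 1 \<omega>) Ustar)\<^sup>2 + (norm (h0 - u 1 \<omega>))\<^sup>2)"
  shows "prob_space.expectation M (\<lambda>\<omega>. (infdist (u (K + 1) \<omega>) Ustar)\<^sup>2)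
           \<le> 32 * d / \<mu> * r1 * exp (- (\<mu> * (real K - 1) / (2 * d)))
             + 432 * \<sigma>\<^sup>2 / (\<mu>\<^sup>2 * (real K - 1))"
proof -
  interpret prob_space M by fact
  have d_pos: "d > 0" "\<mu> \<le> d" using d \<open>\<mu> > 0\<close> by auto
  interpret stochastic_popov M U Ustar F L \<mu> \<Phi> "distr M borel \<xi>" \<xi>s \<alpha> u0 h0
  proof unfold_locales
    show "Ustar \<subseteq> U" unfolding Ustar(1) VI_solutions_def by auto
    show "has_bochner_integral (distr M borel \<xi>) (\<Phi> v) (F v)" if "v \<in> U" for v
    proof -
      have "(\<lambda>s. \<Phi> v s) \<in> borel_measurable borel"
        using that by (intro measurable_comp_restrict_space[OF \<Phi>_measurable]) auto
      then show ?thesis using F_mean[OF that] \<xi>_measurable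
        by (simp add: has_bochner_integral_iff integrable_distr_eq integral_distr)
    qed
  qed (use assms in auto)
  have var: "(\<integral>\<^sup>+\<omega>. (norm (noise k \<omega>))\<^sup>2 \<partial>M) \<le> ennreal (\<sigma>\<^sup>2)" for k
    using variance[of k] unfolding h noise_def[symmetric]
    by (intro nn_integral_le_of_nonneg_cond_exp_le[OF h_measurable]) measurable
  \<comment> \<open>The truncated \<open>k - 1\<close> is harmless: only indices from 1 on are
    used.\<close>
  define R where "R k = (\<integral>\<^sup>+\<omega>. popov_potential Ustar (u k \<omega>) (h (k - 1) \<omega>) \<partial>M)" for k
  define g where "g \<omega> = (infdist (u 1 \<omega>) Ustar)\<^sup>2 + (norm (h0 - u 1 \<omega>))\<^sup>2" for \<omega>
  have g_int: "integrable M g"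
    unfolding g_def[abs_def] u by (rule integrable_first_iterate[OF var])
  have r1_nonneg: "r1 \<ge> 0" unfolding r1 by simp
  have "R (K + 1) \<le> ennreal (32 * d / \<mu> * r1 * exp (- (\<mu> * (real K - 1) / (2 * d)))
      + 432 * \<sigma>\<^sup>2 / (\<mu>\<^sup>2 * (real K - 1)))"
  proof (rule stepsize_recursion_bound)
    have "R 1 \<le> (\<integral>\<^sup>+\<omega>. g \<omega> \<partial>M)"
      unfolding R_def by (intro nn_integral_mono ennreal_leI) (simp add: popov_potential_def g_def h)
    also have "\<dots> = ennreal r1"
      using g_int unfolding r1 g_def[abs_def] by (intro nn_integral_eq_integral) auto
    finally show "R 1 \<le> ennreal r1" .
    fix k assume k: "1 \<le> k" "k \<le> K"
    then obtain j where j: "k = Suc j" by (cases k) auto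
    have "\<alpha> k \<le> 1 / d"
      using \<alpha>_rule[OF k(2)] stepsize_rule_le[of \<mu> d K k] \<open>\<mu> > 0\<close> d_pos by simp
    then have \<alpha>d: "\<alpha> k * d \<le> 1" using d_pos by (simp add: field_simps)
    have "\<mu> * \<alpha> k \<le> d * \<alpha> k" using d_pos \<alpha>_pos[of k] by (intro mult_right_mono) auto
    then have 1: "\<mu> * \<alpha> k \<le> 1" using \<alpha>d by (simp add: mult.commute)
    \<comment> \<open>The constant \<open>2 * sqrt 3\<close> in the bound on \<open>d\<close> is the
      square root of the 12 required by the pathwise step.\<close>
    have "\<alpha> k * (2 * sqrt 3 * L) \<le> \<alpha> k * d" using d \<alpha>_pos[of k] by (intro mult_left_mono) auto
    then have "\<alpha> k * (2 * sqrt 3 * L) \<le> 1" using \<alpha>d by linarith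
    then have "(\<alpha> k * (2 * sqrt 3 * L))\<^sup>2 \<le> 1\<^sup>2"
      using \<open>L > 0\<close> \<alpha>_pos[of k] by (intro power_mono) auto
    then have 2: "12 * (\<alpha> k * L)\<^sup>2 \<le> 1" by (simp add: power_mult_distrib)
    show "R (Suc k) \<le> ennreal (exp (- (\<mu> * stepsize_rule \<mu> d K k))) * R k
        + ennreal (18 * (stepsize_rule \<mu> d K k)\<^sup>2 * \<sigma>\<^sup>2)"
      unfolding \<alpha>_rule[OF k(2), symmetric] unfolding R_def u h j diff_Suc_1
      by (rule expected_potential_step[OF var]) (use 1 2 j in auto)
  qed (use \<open>\<mu> > 0\<close> d_pos \<open>K \<ge> 2\<close> r1_nonneg in auto)
  moreover have "(\<integral>\<^sup>+\<omega>. (infdist (u (K + 1) \<omega>) Ustar)\<^sup>2 \<partial>M) \<le> R (K + 1)"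
    unfolding R_def by (intro nn_integral_mono ennreal_leI) (simp add: popov_potential_def)
  ultimately have "(\<integral>\<^sup>+\<omega>. (infdist (u (K + 1) \<omega>) Ustar)\<^sup>2 \<partial>M)
      \<le> ennreal (32 * d / \<mu> * r1 * exp (- (\<mu> * (real K - 1) / (2 * d)))
      + 432 * \<sigma>\<^sup>2 / (\<mu>\<^sup>2 * (real K - 1)))"
    by (rule order_trans[rotated])
  \<comment> \<open>A finite bound on the nonnegative integral passes to the real expectation once
    the right side is nonnegative.\<close>
  then show ?thesis
    using d_pos \<open>\<mu> > 0\<close> \<open>K \<ge> 2\<close> r1_nonneg by (intro integral_real_bounded) auto
qed

end
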